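(* Let $\mathfrak h$ be one-dimensional. The extension groups $\mathrm{Ext}^1_{M(1)^+}(M(1)^+,M(1)^-)$, $\mathrm{Ext}^1_{M(1)^+}(M(1)^-,M(1)^+)$, and $\mathrm{Ext}^1_{M(1)^+}(M(1,\lambda),M(1,\lambda))$ for every $\lambda\in\mathfrak h\setminus\{0\}$ are nontrivial.
   Context: All vector spaces are over $\mathbb{C}$. For a vertex operator algebra $V$ (with $Y(a,z)=\sum_n a(n)z^{-n-1}$), a weak $V$-module is a vector space $M$ with a linear map $Y:V\to(\mathrm{End}\,M)[[z,z^{-1}]]$ such that $a(n)u=0$ for $n$ large, $Y(\mathbf 1,z)=\mathrm{id}$ and the Jacobi identity holds (no grading required). $\mathrm{Ext}^1_V(M^2,M^1)$ is the abelian group of equivalence classes of short exact sequences $0\to M^1\to M\to M^2\to0$ with $M$ a weak $V$-module; it is zero iff every such sequence splits. Heisenberg vertex operator algebra: $\mathfrak h=\mathbb{C}h$ with symmetric bilinear form, $(h,h)=1$; $\hat{\mathfrak h}=\mathfrak h\otimes\mathbb{C}[x,x^{-1}]\oplus\mathbb{C}C$ with $[X_1\otimes x^m,X_2\otimes x^n]=m(X_1,X_2)\delta_{m,-n}C$, $C$ central; $X(n)$ denotes the action of $X\otimes x^n$. For $\lambda\in\mathfrak h$, $M(1,\lambda)=U(\hat{\mathfrak h})\otimes_{U(\mathfrak h\otimes\mathbb{C}[x]\oplus\mathbb{C}C)}\mathbb{C}e^\lambda$, where $C$ acts as $1$ and $X(n)e^\lambda=\delta_{n,0}(X,\lambda)e^\lambda$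 for $n\ge0$. $M(1)=M(1,0)$ is the Heisenberg vertex operator algebra with $\mathbf 1=e^0$, $\omega=\frac12h(-1)^2\mathbf 1$, $Y(h(-1)\mathbf 1,z)=\sum_{n\in\mathbb{Z}}h(n)z^{-n-1}$, and each $M(1,\lambda)$ is an $M(1)$-module. $\theta$ is the automorphism of $M(1)$ with $\theta(h(-n_1)\cdots h(-n_r)\mathbf 1)=(-1)^rh(-n_1)\cdots h(-n_r)\mathbf 1$; $M(1)^\pm$ are its $\pm1$-eigenspaces; $M(1)^+$ is a vertex operator algebra, and $M(1)^-$ and $M(1,\lambda)$ are regarded as $M(1)^+$-modules. *)

theory Defs
  imports Complex_Main "HOL-Library.Multiset" "HOL-Library.Poly_Mapping"
    "HOL-Library.Groups_Big_Fun" "HOL-Library.Product_Plus" "HOL-Algebra.Group"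
begin

section \<open>Complex vector spaces\<close>

class complex_vector = ab_group_add +
  fixes cscale :: "complex \<Rightarrow> 'a \<Rightarrow> 'a" (infixr \<open>*\<^sub>C\<close> 75)
  assumes cscale_add_right: "a *\<^sub>C (x + y) = a *\<^sub>C x + a *\<^sub>C y"
    and cscale_add_left: "(a + b) *\<^sub>C x = a *\<^sub>C x + b *\<^sub>C x"
    and cscale_cscale: "a *\<^sub>C b *\<^sub>C x = (a * b) *\<^sub>C x"
    and cscale_one: "1 *\<^sub>C x = x"

global_interpretation cvec: vector_space "cscale :: complex \<Rightarrow> 'a \<Rightarrow> 'a::complex_vector"
  by unfold_locales (rule cscale_add_right cscale_add_left cscale_cscale cscale_one)+

instantiation complex :: complex_vector
begin
definition cscale_complex :: "complex \<Rightarrow> complex \<Rightarrow> complex" where "cscale_complex = (*)"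
instance by standard (simp_all add: cscale_complex_def algebra_simps)
end

instantiation prod :: (complex_vector, complex_vector) complex_vector
begin
definition cscale_prod :: "complex \<Rightarrow> 'a \<times> 'b \<Rightarrow> 'a \<times> 'b"
  where "c *\<^sub>C u = (c *\<^sub>C fst u, c *\<^sub>C snd u)"
instance
  by standard (simp_all add: cscale_prod_def prod_eq_iff cscale_add_right cscale_add_left
      cscale_cscale cscale_one)
end

instantiation poly_mapping :: (type, complex_vector) complex_vector
begin
definition cscale_poly_mapping :: "complex \<Rightarrow> ('a \<Rightarrow>\<^sub>0 'b) \<Rightarrow> ('a \<Rightarrow>\<^sub>0 'b)"
  where "cscale_poly_mapping c = Poly_Mapping.map (cscale c)"

lemma lookup_cscale [simp]: "Poly_Mapping.lookup (c *\<^sub>C u) k = c *\<^sub>C Poly_Mapping.lookup u k"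
  for u :: "'a \<Rightarrow>\<^sub>0 'b"
  by (simp add: cscale_poly_mapping_def Poly_Mapping.map.rep_eq when_def cvec.scale_zero_right)

instance
  by standard (rule poly_mapping_eqI; simp add: lookup_add cscale_add_right cscale_add_left
      cscale_cscale cscale_one)+
end

definition linear_between :: "'a::complex_vector set \<Rightarrow> 'b::complex_vector set \<Rightarrow> ('a \<Rightarrow> 'b) \<Rightarrow> bool"
  where "linear_between S T f \<longleftrightarrow> f \<in> S \<rightarrow> T \<and>
    (\<forall>x\<in>S. \<forall>y\<in>S. f (x + y) = f x + f y) \<and> (\<forall>c. \<forall>x\<in>S. f (c *\<^sub>C x) = c *\<^sub>C f x)"

section \<open>Weak modules and their extensions\<close>

text \<open>
  A vertex operator $Y(a,z) = \sum_n a(n) z^{-n-1}$ is encoded by its modes: \<open>voa_Y V a n b\<close> is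
  $a(n)b$, and \<open>act M a n u\<close> is $a(n)u$ for $u$ in a module.  The underlying spaces are subspaces of
  types; the operations are irrelevant outside these subspaces.
\<close>

record 'v voa =
  voa_space :: "'v set"
  voa_Y :: "'v \<Rightarrow> int \<Rightarrow> 'v \<Rightarrow> 'v"
  vacuum :: 'v
  conformal :: 'v

record ('v, 'm) wmodule =
  space :: "'m set"
  act :: "'v \<Rightarrow> int \<Rightarrow> 'm \<Rightarrow> 'm"

text \<open>
  The Jacobi identity
  \[ z_0^{-1}\delta\Bigl(\frac{z_1-z_2}{z_0}\Bigr)Y(a,z_1)Y(b,z_2)
   - z_0^{-1}\delta\Bigl(\frac{z_2-z_1}{-z_0}\Bigr)Y(b,z_2)Y(a,z_1)
   = z_2^{-1}\delta\Bigl(\frac{z_1-z_0}{z_2}\Bigr)Y(Y(a,z_0)b,z_2), \]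
  all binomials being expanded in nonnegative powers of the second variable, is stated as the
  equality of the coefficients of $z_0^{-r-1}z_1^{-p-1}z_2^{-q-1}$, applied to $u$.  All but finitely
  many summands vanish (by truncation in the vertex algebra and in the module), so that \<open>Sum_any\<close>
  is the actual sum.
\<close>

definition jacobi_identity ::
  "('v::complex_vector) voa \<Rightarrow> ('v, 'm::complex_vector) wmodule \<Rightarrow> 'v \<Rightarrow> 'v \<Rightarrow> 'm \<Rightarrow> bool"
  where "jacobi_identity V M a b u \<longleftrightarrow> (\<forall>p q r :: int.
    Sum_any (\<lambda>i::nat. (of_int p gchoose i) *\<^sub>C act M (voa_Y V a (r + int i) b) (p + q - int i) u) =
    Sum_any (\<lambda>i::nat. ((- 1) ^ i * (of_int r gchoose i)) *\<^sub>C
      (act M a (p + r - int i) (act M b (q + int i) u)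
        - ((- 1) powi r) *\<^sub>C act M b (q + r - int i) (act M a (p + int i) u))))"

definition weak_module :: "('v::complex_vector) voa \<Rightarrow> ('v, 'm::complex_vector) wmodule \<Rightarrow> bool"
  where "weak_module V M \<longleftrightarrow>
    cvec.subspace (space M) \<and>
    (\<forall>a\<in>voa_space V. \<forall>n. linear_between (space M) (space M) (act M a n)) \<and>
    (\<forall>n. \<forall>u\<in>space M. linear_between (voa_space V) (space M) (\<lambda>a. act M a n u)) \<and>
    (\<forall>a\<in>voa_space V. \<forall>u\<in>space M. \<exists>N. \<forall>n\<ge>N. act M a n u = 0) \<and>
    (\<forall>n. \<forall>u\<in>space M. act M (vacuum V) n u = (if n = - 1 then u else 0)) \<and>
    (\<forall>a\<in>voa_space V. \<forall>b\<in>voa_space V. \<forall>u\<in>space M. jacobi_identity V M a b u)"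

definition adjoint_module :: "'v voa \<Rightarrow> ('v, 'v) wmodule"
  where "adjoint_module V = \<lparr>space = voa_space V, act = voa_Y V\<rparr>"

definition module_hom_on ::
  "'v voa \<Rightarrow> ('v, 'm::complex_vector) wmodule \<Rightarrow> ('v, 'n::complex_vector) wmodule \<Rightarrow> ('m \<Rightarrow> 'n) \<Rightarrow> bool"
  where "module_hom_on V M N f \<longleftrightarrow> linear_between (space M) (space N) f \<and>
    (\<forall>a\<in>voa_space V. \<forall>n. \<forall>u\<in>space M. f (act M a n u) = act N a n (f u))"

text \<open>
  An extension $0 \to M_1 \to M \to M_2 \to 0$ is the triple of $M$ and the two maps.  As a vector
  space $M$ is isomorphic to $M_1 \oplus M_2$, so every extension is equivalent to one whose middle
  term is a subspace of the product of the two types; this fixes the universe for $M$.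
\<close>

type_synonym ('v, 'a, 'b) extn = "('v, 'a \<times> 'b) wmodule \<times> ('a \<Rightarrow> 'a \<times> 'b) \<times> ('a \<times> 'b \<Rightarrow> 'b)"

definition extensions ::
  "('v::complex_vector) voa \<Rightarrow> ('v, 'b::complex_vector) wmodule \<Rightarrow> ('v, 'a::complex_vector) wmodule
    \<Rightarrow> ('v, 'a, 'b) extn set"
  where "extensions V M2 M1 = {(M, i, p). weak_module V M \<and>
    module_hom_on V M1 M i \<and> module_hom_on V M M2 p \<and>
    inj_on i (space M1) \<and> i ` space M1 = {u \<in> space M. p u = 0} \<and> p ` space M = space M2}"

definition extension_equiv ::
  "('v::complex_vector) voa \<Rightarrow> ('v, 'b::complex_vector) wmodule \<Rightarrow> ('v, 'a::complex_vector) wmodule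
    \<Rightarrow> ('v, 'a, 'b) extn rel"
  where "extension_equiv V M2 M1 =
    {((M, i, p), (M', i', p')).
      (M, i, p) \<in> extensions V M2 M1 \<and> (M', i', p') \<in> extensions V M2 M1 \<and>
      (\<exists>f. module_hom_on V M M' f \<and> bij_betw f (space M) (space M') \<and>
        (\<forall>x\<in>space M1. f (i x) = i' x) \<and> (\<forall>u\<in>space M. p' (f u) = p u))}"

definition direct_sum ::
  "('v, 'a) wmodule \<Rightarrow> ('v, 'b) wmodule \<Rightarrow> ('v, 'a \<times> 'b) wmodule"
  where "direct_sum M1 M2 =
    \<lparr>space = space M1 \<times> space M2, act = (\<lambda>a n (x, y). (act M1 a n x, act M2 a n y))\<rparr>"

definition split_extension ::
  "('v, 'b) wmodule \<Rightarrow> ('v, 'a) wmodule \<Rightarrow> ('v, 'a::complex_vector, 'b::complex_vector) extn"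
  where "split_extension M2 M1 = (direct_sum M1 M2, \<lambda>x. (x, 0), snd)"

definition fiber_product ::
  "('v, 'm) wmodule \<Rightarrow> ('m \<Rightarrow> 'b) \<Rightarrow> ('v, 'n) wmodule \<Rightarrow> ('n \<Rightarrow> 'b) \<Rightarrow> ('v, 'm \<times> 'n) wmodule"
  where "fiber_product M p M' p' = direct_sum M M' \<lparr>space := {(u, u') \<in> space M \<times> space M'. p u = p' u'}\<rparr>"

text \<open>
  The Baer sum is the fiber product $M \times_{M_2} M'$ modulo the antidiagonal copy of $M_1$.  An
  extension $N$ represents it iff it admits a homomorphism \<open>f\<close> from the fiber product as below: such
  an \<open>f\<close> is onto and its kernel is exactly the antidiagonal $\{(i(x), i'(-x))\}$.
\<close>

definition is_baer_sum ::
  "('v::complex_vector) voa \<Rightarrow> ('v, 'a::complex_vector) wmodule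
    \<Rightarrow> ('v, 'a, 'b::complex_vector) extn \<Rightarrow> ('v, 'a, 'b) extn \<Rightarrow> ('v, 'a, 'b) extn \<Rightarrow> bool"
  where "is_baer_sum V M1 = (\<lambda>(M, i, p) (M', i', p') (N, j, q).
    \<exists>f. module_hom_on V (fiber_product M p M' p') N f \<and>
      (\<forall>x\<in>space M1. \<forall>y\<in>space M1. f (i x, i' y) = j (x + y)) \<and>
      (\<forall>(u, u')\<in>space (fiber_product M p M' p'). q (f (u, u')) = p u))"

text \<open>\<open>Ext1 V M2 M1\<close> is $\mathrm{Ext}^1_V(M_2, M_1)$.\<close>

definition Ext1 ::
  "('v::complex_vector) voa \<Rightarrow> ('v, 'b::complex_vector) wmodule \<Rightarrow> ('v, 'a::complex_vector) wmodule
    \<Rightarrow> ('v, 'a, 'b) extn set monoid"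
  where "Ext1 V M2 M1 =
    \<lparr>carrier = extensions V M2 M1 // extension_equiv V M2 M1,
     mult = (\<lambda>A B. {E \<in> extensions V M2 M1. \<exists>E1\<in>A. \<exists>E2\<in>B. is_baer_sum V M1 E1 E2 E}),
     one = extension_equiv V M2 M1 `` {split_extension M2 M1}\<rparr>"

lemma module_hom_on_inverse:
  assumes f: "module_hom_on V M N f" "bij_betw f (space M) (space N)" and M: "weak_module V M"
  shows "module_hom_on V N M (the_inv_into (space M) f)"
proof -
  let ?g = "the_inv_into (space M) f"
  have sub: "cvec.subspace (space M)"
    and act: "\<And>a n u. a \<in> voa_space V \<Longrightarrow> u \<in> space M \<Longrightarrow> act M a n u \<in> space M"
    using M by (auto simp: weak_module_def linear_between_def Pi_iff)
  have inj: "inj_on f (space M)" and N: "space N = f ` space M"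
    using f(2) by (auto simp: bij_betw_def)
  have gf: "?g (f u) = u" if "u \<in> space M" for u
    using that inj by (simp add: the_inv_into_f_f)
  have hom: "f (x + y) = f x + f y" "f (c *\<^sub>C x) = c *\<^sub>C f x" "f (act M a n x) = act N a n (f x)"
    if "x \<in> space M" "y \<in> space M" "a \<in> voa_space V" for x y c a n
    using f(1) that by (auto simp: module_hom_on_def linear_between_def)
  have lin: "f (x + y) = f x + f y" "f (c *\<^sub>C x) = c *\<^sub>C f x"
    if "x \<in> space M" "y \<in> space M" for x y c
    using f(1) that by (auto simp: module_hom_on_def linear_between_def)
  show ?thesis
    unfolding module_hom_on_def linear_between_def N
    using sub act
    by (auto simp: gf cvec.subspace_add cvec.subspace_scale simp flip: lin hom)
qed

lemma module_hom_on_compose: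
  "module_hom_on V M N f \<Longrightarrow> module_hom_on V N K g \<Longrightarrow> module_hom_on V M K (g \<circ> f)"
  by (auto simp: module_hom_on_def linear_between_def Pi_iff)

lemma equiv_extension_equiv: "equiv (extensions V M2 M1) (extension_equiv V M2 M1)"
proof (rule equivI)
  show "extension_equiv V M2 M1 \<subseteq> extensions V M2 M1 \<times> extensions V M2 M1"
    by (auto simp: extension_equiv_def)
  show "refl_on (extensions V M2 M1) (extension_equiv V M2 M1)"
    by (auto simp: refl_on_def extension_equiv_def module_hom_on_def linear_between_def
        intro!: exI[of _ "\<lambda>x. x"] bij_betw_imageI)
  show "sym (extension_equiv V M2 M1)"
  proof (rule symI, clarify)
    fix M i p M' i' p'
    assume "((M, i, p), (M', i', p')) \<in> extension_equiv V M2 M1"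
    then obtain f where E: "(M, i, p) \<in> extensions V M2 M1" "(M', i', p') \<in> extensions V M2 M1"
      and f: "module_hom_on V M M' f" and bij: "bij_betw f (space M) (space M')"
      and fi: "\<forall>x\<in>space M1. f (i x) = i' x" and pf: "\<forall>u\<in>space M. p' (f u) = p u"
      by (auto simp: extension_equiv_def)
    let ?g = "the_inv_into (space M) f"
    have inj: "inj_on f (space M)" and M': "space M' = f ` space M"
      using bij by (auto simp: bij_betw_def)
    have "module_hom_on V M' M ?g"
      using E f bij by (auto simp: extensions_def intro: module_hom_on_inverse)
    moreover have "bij_betw ?g (space M') (space M)"
      using bij by (rule bij_betw_the_inv_into)
    moreover have "?g (i' x) = i x" if "x \<in> space M1" for x
    proof -
      have "i x \<in> space M" using E that by (auto simp: extensions_def)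
      then show ?thesis using fi that inj by (metis the_inv_into_f_f)
    qed
    moreover have "p (?g u) = p' u" if "u \<in> space M'" for u
      using that pf inj by (auto simp: M' the_inv_into_f_f)
    ultimately show "((M', i', p'), (M, i, p)) \<in> extension_equiv V M2 M1"
      using E by (auto simp: extension_equiv_def)
  qed
  show "trans (extension_equiv V M2 M1)"
  proof (rule transI, clarify)
    fix M i p M' i' p' M'' i'' p''
    assume "((M, i, p), (M', i', p')) \<in> extension_equiv V M2 M1"
      and "((M', i', p'), (M'', i'', p'')) \<in> extension_equiv V M2 M1"
    then obtain f g where E: "(M, i, p) \<in> extensions V M2 M1" "(M'', i'', p'') \<in> extensions V M2 M1"
      and fg: "module_hom_on V M M' f" "module_hom_on V M' M'' g"
      and bij: "bij_betw f (space M) (space M')" "bij_betw g (space M') (space M'')"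
      and *: "\<forall>x\<in>space M1. f (i x) = i' x" "\<forall>u\<in>space M. p' (f u) = p u"
        "\<forall>x\<in>space M1. g (i' x) = i'' x" "\<forall>u\<in>space M'. p'' (g u) = p' u"
      by (auto simp: extension_equiv_def)
    have "\<forall>u\<in>space M. f u \<in> space M'" using bij by (auto simp: bij_betw_def)
    then show "((M, i, p), (M'', i'', p'')) \<in> extension_equiv V M2 M1"
      using E * module_hom_on_compose[OF fg] bij_betw_trans[OF bij]
      by (auto simp: extension_equiv_def intro!: exI[of _ "g \<circ> f"])
  qed
qed

lemma Ext1_class_eq_one_iff_splits:
  assumes E: "(M, i, p) \<in> extensions V M2 M1"
    and split: "split_extension M2 M1 \<in> extensions V M2 M1"
  shows "extension_equiv V M2 M1 `` {(M, i, p)} = \<one>\<^bsub>Ext1 V M2 M1\<^esub> \<longleftrightarrow>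
    (\<exists>s. module_hom_on V M2 M s \<and> (\<forall>y\<in>space M2. p (s y) = y))" (is "_ = ?splits")
proof -
  let ?D = "direct_sum M1 M2"
  have "extension_equiv V M2 M1 `` {(M, i, p)} = \<one>\<^bsub>Ext1 V M2 M1\<^esub> \<longleftrightarrow>
      (split_extension M2 M1, (M, i, p)) \<in> extension_equiv V M2 M1"
    using eq_equiv_class_iff[OF equiv_extension_equiv split E] by (simp add: Ext1_def eq_commute)
  also have "\<dots> \<longleftrightarrow> ?splits"
  proof
    assume "(split_extension M2 M1, (M, i, p)) \<in> extension_equiv V M2 M1"
    then obtain f where f: "module_hom_on V ?D M f" and pf: "\<forall>u\<in>space ?D. p (f u) = snd u"
      by (auto simp: extension_equiv_def split_extension_def)
    have D: "weak_module V ?D" using split by (auto simp: extensions_def split_extension_def)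
    have z: "0 \<in> space M1" and s2: "cvec.subspace (space ?D)"
      using D by (auto simp: weak_module_def direct_sum_def cvec.subspace_def zero_prod_def)
    have lin: "linear_between (space ?D) (space ?D) (act ?D a n)" if "a \<in> voa_space V" for a n
      using D that by (auto simp: weak_module_def)
    have a0: "act M1 a n 0 = 0" if "a \<in> voa_space V" for a n
    proof -
      have "act ?D a n (0 *\<^sub>C 0) = 0 *\<^sub>C act ?D a n 0"
        using lin[OF that, of n] s2 unfolding linear_between_def cvec.subspace_def by blast
      then show ?thesis by (simp add: direct_sum_def zero_prod_def)
    qed
    have "module_hom_on V M2 M (\<lambda>y. f (0, y))"
      using f z a0
      by (auto simp: module_hom_on_def linear_between_def direct_sum_def Pi_iff cscale_prod_def)
        (smt (verit) SigmaI add.right_neutral add_Pair cvec.scale_zero_right fst_conv snd_conv)+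
    with pf z show ?splits
      by (intro exI[of _ "\<lambda>y. f (0, y)"]) (auto simp: direct_sum_def)
  next
    assume ?splits
    then obtain s where s: "module_hom_on V M2 M s" and ps: "\<forall>y\<in>space M2. p (s y) = y" by auto
    have M: "weak_module V M" and i: "module_hom_on V M1 M i" and p: "module_hom_on V M M2 p"
      and inj: "inj_on i (space M1)" and ker: "i ` space M1 = {u \<in> space M. p u = 0}"
      and onto: "p ` space M = space M2"
      using E by (auto simp: extensions_def)
    have sub: "cvec.subspace (space M)" using M by (simp add: weak_module_def)
    have iM: "i x \<in> space M" "p (i x) = 0" if "x \<in> space M1" for x using ker that by auto
    have sM: "s y \<in> space M" if "y \<in> space M2" for y
      using s that by (auto simp: module_hom_on_def linear_between_def)
    have padd: "p (u + v) = p u + p v" "p (c *\<^sub>C u) = c *\<^sub>C p u" if "u \<in> space M" "v \<in> space M" for u v c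
      using p that by (auto simp: module_hom_on_def linear_between_def)
    define f where "f = (\<lambda>(x, y). i x + s y)"
    have pf: "p (f (x, y)) = y" if "x \<in> space M1" "y \<in> space M2" for x y
      using that by (simp add: f_def padd iM sM ps)
    have actadd: "act M a n (u + v) = act M a n u + act M a n v"
      if "a \<in> voa_space V" "u \<in> space M" "v \<in> space M" for a n u v
      using M that by (auto simp: weak_module_def linear_between_def)
    have "module_hom_on V ?D M f"
      using i s actadd iM sM sub
      by (auto simp: module_hom_on_def linear_between_def direct_sum_def f_def cscale_prod_def
          cvec.subspace_add cscale_add_right)
    moreover have "bij_betw f (space ?D) (space M)"
    proof (rule bij_betw_imageI)
      show "inj_on f (space ?D)"
      proof (rule inj_onI, clarsimp simp: direct_sum_def)
        fix x y x' y'
        assume *: "x \<in> space M1" "y \<in> space M2" "x' \<in> space M1" "y' \<in> space M2" "f (x, y) = f (x', y')"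
        then have "y = y'" using pf by metis
        with * inj show "x = x' \<and> y = y'" by (auto simp: f_def inj_on_def)
      qed
      show "f ` space ?D = space M"
      proof (intro equalityI subsetI)
        fix u assume "u \<in> f ` space ?D"
        then show "u \<in> space M" using iM sM sub by (auto simp: direct_sum_def f_def cvec.subspace_add)
      next
        fix u assume u: "u \<in> space M"
        then have pu: "p u \<in> space M2" using onto by auto
        define v where "v = (- 1) *\<^sub>C s (p u)"
        have v: "v \<in> space M" "p v = (- 1) *\<^sub>C p u"
          unfolding v_def using sM[OF pu] sub pu by (simp_all only: padd ps cvec.subspace_scale)
        have "u + v \<in> {u \<in> space M. p u = 0}"
          using u v sub by (simp add: padd cvec.subspace_add)
        then obtain x where "x \<in> space M1" "i x = u + v" using ker by force
        then show "u \<in> f ` space ?D"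
          using pu by (auto simp: direct_sum_def f_def v_def intro!: rev_image_eqI[of "(x, p u)"])
      qed
    qed
    moreover have "f (x, 0) = i x" if "x \<in> space M1" for x
    proof -
      have "0 \<in> space M2"
        using iM that onto by force
      then have "s 0 = 0"
        using s unfolding module_hom_on_def linear_between_def by (metis cvec.scale_zero_left)
      then show ?thesis by (simp add: f_def)
    qed
    ultimately show "(split_extension M2 M1, (M, i, p)) \<in> extension_equiv V M2 M1"
      using E split pf
      by (auto simp: extension_equiv_def split_extension_def intro!: exI[of _ f])
        (auto simp: direct_sum_def)
  qed
  finally show ?thesis .
qed

section \<open>The Heisenberg algebra and its Fock modules\<close>

text \<open>
  A level one module for $\hat{\mathfrak h}$, $\mathfrak h = \mathbb{C}h$, is given by the operators
  $h(n)$; the central element acts as 1.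
\<close>

definition heisenberg_rep :: "(int \<Rightarrow> 'w::complex_vector \<Rightarrow> 'w) \<Rightarrow> bool"
  where "heisenberg_rep h \<longleftrightarrow> (\<forall>n. linear_between UNIV UNIV (h n)) \<and>
    (\<forall>m n w. h m (h n w) - h n (h m w) = (if m = - n then of_int m *\<^sub>C w else 0))"

text \<open>
  All $M(1,\lambda)$ have the same underlying space, the polynomial ring in $x_0, x_1, \dots$: the
  Poincare-Birkhoff-Witt basis vector $h(-k_1-1)\cdots h(-k_r-1)e^\lambda$ is the monomial
  $x_{k_1}\cdots x_{k_r}$, indexed by the multiset $\{k_1,\dots,k_r\}$.  An element $\lambda$ of
  $\mathfrak h = \mathbb{C}h$ is identified with the number $(h,\lambda)$, that is,
  $\lambda = (h,\lambda)h$.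
\<close>

type_synonym fock = "nat multiset \<Rightarrow>\<^sub>0 complex"

definition fock_deriv :: "nat \<Rightarrow> fock \<Rightarrow> fock"  \<comment> \<open>$\partial/\partial x_k$\<close>
  where "fock_deriv k u =
    (\<Sum>A\<in>Poly_Mapping.keys u. Poly_Mapping.single (A - {#k#}) (of_nat (count A k) * Poly_Mapping.lookup u A))"

text \<open>\<open>heis \<nu> n\<close> is the action of $h(n)$ on $M(1,\lambda)$, where $\nu = (h,\lambda)$.\<close>

definition heis :: "complex \<Rightarrow> int \<Rightarrow> fock \<Rightarrow> fock"
  where "heis \<nu> n u =
    (if n < 0 then Poly_Mapping.single {#nat (- n - 1)#} 1 * u
     else if n = 0 then \<nu> *\<^sub>C u
     else of_int n *\<^sub>C fock_deriv (nat (n - 1)) u)"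

lemma linear_between_UNIV:
  "linear_between UNIV UNIV f \<longleftrightarrow>
    (\<forall>x y. f (x + y) = f x + f y) \<and> (\<forall>c x. f (c *\<^sub>C x) = c *\<^sub>C f x)"
  by (simp add: linear_between_def)

lemma lookup_fock_deriv:
  "Poly_Mapping.lookup (fock_deriv k u) A =
    of_nat (Suc (count A k)) * Poly_Mapping.lookup u (add_mset k A)"
proof -
  let ?c = "of_nat (Suc (count A k)) * Poly_Mapping.lookup u (add_mset k A)"
  have "Poly_Mapping.lookup (fock_deriv k u) A = (\<Sum>B\<in>Poly_Mapping.keys u.
      (of_nat (count B k) * Poly_Mapping.lookup u B when B - {#k#} = A))"
    by (simp add: fock_deriv_def lookup_sum lookup_single)
  also have "\<dots> = (\<Sum>B\<in>Poly_Mapping.keys u. if B = add_mset k A then ?c else 0)"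
  proof (rule sum.cong[OF refl], goal_cases)
    case (1 B)
    show ?case
    proof (cases "k \<in># B")
      case True
      then obtain C where "B = add_mset k C" by (meson mset_add)
      then show ?thesis by (auto simp: when_def)
    next
      case False
      then show ?thesis by (auto simp: when_def not_in_iff)
    qed
  qed
  also have "\<dots> = ?c"
    by (auto simp: in_keys_iff)
  finally show ?thesis .
qed

abbreviation mon :: "nat multiset \<Rightarrow> fock" where "mon A \<equiv> Poly_Mapping.single A 1"

lemma fock_expand: "u = (\<Sum>A\<in>Poly_Mapping.keys u. Poly_Mapping.lookup u A *\<^sub>C mon A)" for u :: fock
  by (rule poly_mapping_eqI)
    (auto simp: lookup_sum lookup_single when_def cscale_complex_def in_keys_iff if_distrib cong: if_cong)

lemma linear_sum:
  assumes "linear_between UNIV UNIV f"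
  shows "f (\<Sum>A\<in>S. c A *\<^sub>C g A) = (\<Sum>A\<in>S. c A *\<^sub>C f (g A))"
proof -
  have "f 0 = 0" using assms unfolding linear_between_UNIV by (metis cvec.scale_zero_left)
  then show ?thesis using assms
    by (induction S rule: infinite_finite_induct) (auto simp: linear_between_UNIV)
qed

lemma linear_eqI:
  fixes f g :: "fock \<Rightarrow> 'w::complex_vector"
  assumes "linear_between UNIV UNIV f" "linear_between UNIV UNIV g" "\<And>A. f (mon A) = g (mon A)"
  shows "f u = g u"
  by (subst (1 2) fock_expand[of u]) (simp add: linear_sum[OF assms(1)] linear_sum[OF assms(2)] assms(3))

lemma linear_fock_deriv: "linear_between UNIV UNIV (fock_deriv k)"
  unfolding linear_between_UNIV
  by (auto intro!: poly_mapping_eqI simp: lookup_fock_deriv lookup_add cscale_complex_def algebra_simps)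

lemma cscale_conv_times: "c *\<^sub>C u = Poly_Mapping.single 0 c * u" for u :: fock
  using mult_map_scale_conv_mult[of c u] by (simp add: cscale_poly_mapping_def cscale_complex_def)

lemma cscale_times: "u * (c *\<^sub>C v) = c *\<^sub>C (u * v)" "(c *\<^sub>C u) * v = c *\<^sub>C (u * v)" for u v :: fock
  by (simp_all add: cscale_conv_times mult_ac)

lemma mon_add_mset: "mon (add_mset k A) = mon {#k#} * mon A"
  by (simp add: mult_single)

lemma fock_deriv_mon: "fock_deriv k (mon A) = of_nat (count A k) *\<^sub>C mon (A - {#k#})"
  by (rule poly_mapping_eqI) (auto simp: fock_deriv_def lookup_single when_def cscale_complex_def)

lemma fock_deriv_var_times:
  "fock_deriv k (mon {#l#} * u) = mon {#l#} * fock_deriv k u + (if k = l then u else 0)"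
proof (rule linear_eqI[where u = u], goal_cases)
  case (3 A)
  have *: "of_nat (count A k) *\<^sub>C mon (add_mset l A - {#k#}) =
      of_nat (count A k) *\<^sub>C mon (add_mset l (A - {#k#}))"
    by (cases "k \<in># A") (auto simp: not_in_iff)
  show ?case
    using * by (auto simp flip: mon_add_mset simp: fock_deriv_mon cscale_times cvec.scale_left_distrib)
qed (use linear_fock_deriv in \<open>auto simp: linear_between_UNIV cscale_times algebra_simps cvec.scale_right_distrib\<close>)

lemma fock_deriv_commute: "fock_deriv k (fock_deriv l u) = fock_deriv l (fock_deriv k u)"
  by (rule poly_mapping_eqI) (simp add: lookup_fock_deriv add_mset_commute)

lemma heisenberg_rep_heis: "heisenberg_rep (heis \<nu>)"
  unfolding heisenberg_rep_def
proof (intro conjI allI)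
  show lin: "linear_between UNIV UNIV (heis \<nu> n)" for n
    using linear_fock_deriv
    by (auto simp: heis_def linear_between_UNIV cscale_times algebra_simps cscale_add_right
        cscale_cscale)
  fix m n :: int and w
  have pos: "fock_deriv k (c *\<^sub>C u) = c *\<^sub>C fock_deriv k u" for k c u
    using linear_fock_deriv by (simp add: linear_between_UNIV)
  consider "m = 0 \<or> n = 0" | "m < 0" "n < 0" | "m > 0" "n > 0" | "m < 0" "n > 0" | "m > 0" "n < 0"
    by linarith
  then show "heis \<nu> m (heis \<nu> n w) - heis \<nu> n (heis \<nu> m w) = (if m = - n then of_int m *\<^sub>C w else 0)"
  proof cases
    case 1
    then show ?thesis using lin by (auto simp: linear_between_UNIV heis_def[of \<nu> 0])
  next
    case 2
    then show ?thesis by (simp add: heis_def mult_ac)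
  next
    case 3
    then show ?thesis
      by (simp add: heis_def pos cscale_cscale fock_deriv_commute[of "nat (m - 1)"] mult_ac)
  next
    case 4
    then have "nat (n - 1) = nat (- m - 1) \<longleftrightarrow> m = - n" by auto
    with 4 show ?thesis
      by (auto simp: heis_def cscale_times fock_deriv_var_times cscale_add_right)
  next
    case 5
    then have "nat (m - 1) = nat (- n - 1) \<longleftrightarrow> m = - n" by auto
    with 5 show ?thesis
      by (auto simp: heis_def cscale_times fock_deriv_var_times cscale_add_right)
  qed
qed

text \<open>
  The universal property characterizing
  $U(\hat{\mathfrak h}) \otimes_{U(\mathfrak h \otimes \mathbb{C}[x] \oplus \mathbb{C}C)} \mathbb{C}e^\lambda$,
  with $e^\lambda = 1$.
\<close>

lemma heis_vacuum: "n \<ge> 0 \<Longrightarrow> heis \<nu> n 1 = (if n = 0 then \<nu> *\<^sub>C 1 else 0)"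
  by (auto simp: heis_def fock_deriv_mon simp flip: single_one)

lemma heis_universal:
  fixes h :: "int \<Rightarrow> 'w::complex_vector \<Rightarrow> 'w"
  assumes h: "heisenberg_rep h" and w: "\<And>n. n \<ge> 0 \<Longrightarrow> h n w = (if n = 0 then \<nu> *\<^sub>C w else 0)"
  shows "\<exists>!f. linear_between UNIV UNIV f \<and> (\<forall>n u. f (heis \<nu> n u) = h n (f u)) \<and> f 1 = w"
proof -
  have lin: "linear_between UNIV UNIV (h n)" for n
    using h by (simp add: heisenberg_rep_def)
  have add: "h n (x + y) = h n x + h n y" and scale: "h n (c *\<^sub>C x) = c *\<^sub>C h n x" for n x y c
    using lin by (simp_all add: linear_between_UNIV)
  have comm: "h m (h n x) = h n (h m x) + (if m = - n then of_int m *\<^sub>C x else 0)" for m n x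
  proof -
    have "h m (h n x) - h n (h m x) = (if m = - n then of_int m *\<^sub>C x else 0)"
      using h unfolding heisenberg_rep_def by blast
    then show ?thesis by (simp only: diff_eq_eq add.commute)
  qed
  define cr where "cr k = h (- int k - 1)" for k
  interpret cr: comp_fun_commute cr
  proof
    fix k l
    show "cr l \<circ> cr k = cr k \<circ> cr l"
      using comm[of "- int k - 1" "- int l - 1"] by (auto simp: cr_def)
  qed
  define B where "B A = fold_mset cr w A" for A
  have B_add: "B (add_mset k A) = cr k (B A)" and B_empty: "B {#} = w" for k A
    by (simp_all add: B_def)
  define f where "f u = (\<Sum>A\<in>Poly_Mapping.keys u. Poly_Mapping.lookup u A *\<^sub>C B A)" for u :: fock
  have f_super: "f u = (\<Sum>A\<in>S. Poly_Mapping.lookup u A *\<^sub>C B A)"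
    if "finite S" "Poly_Mapping.keys u \<subseteq> S" for u S
    unfolding f_def using that by (intro sum.mono_neutral_left) (auto simp: in_keys_iff)
  have f_mon: "f (mon A) = B A" for A
    by (simp add: f_def cscale_one)
  have f_lin: "linear_between UNIV UNIV f"
    unfolding linear_between_UNIV
  proof (intro conjI allI)
    fix x y :: fock and c
    let ?S = "Poly_Mapping.keys x \<union> Poly_Mapping.keys y"
    show "f (x + y) = f x + f y"
      using Poly_Mapping.keys_add[of x y]
      by (simp add: f_super[of ?S] lookup_add cvec.scale_left_distrib sum.distrib)
    have "Poly_Mapping.keys (c *\<^sub>C x) \<subseteq> Poly_Mapping.keys x"
      by (auto simp: in_keys_iff cscale_complex_def)
    then show "f (c *\<^sub>C x) = c *\<^sub>C f x"
      by (simp add: f_super[of "Poly_Mapping.keys x"] cvec.scale_sum_right cscale_cscale cscale_complex_def)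
  qed
  then have f_add: "f (x + y) = f x + f y" and f_scale: "f (c *\<^sub>C x) = c *\<^sub>C f x" for x y c
    by (simp_all add: linear_between_UNIV)
  have neg: "f (mon {#k#} * u) = cr k (f u)" for k u
    by (rule linear_eqI[where u = u])
      (use f_lin in \<open>auto simp: linear_between_UNIV cr_def add scale cscale_times distrib_left f_mon
        B_add simp flip: mon_add_mset\<close>)
  have zero: "h 0 (B A) = \<nu> *\<^sub>C B A" for A
  proof (induction A)
    case empty
    then show ?case by (simp add: B_empty w)
  next
    case (add k A)
    then show ?case
      using comm[of 0 "- int k - 1" "B A"] by (simp add: B_add cr_def scale)
  qed
  have pos: "f (heis \<nu> (int k + 1) (mon A)) = h (int k + 1) (B A)" for k A
  proof (induction A)
    case empty
    then show ?case using heis_vacuum[of "int k + 1" \<nu>] f_lin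
      by (simp add: B_empty w f_def)
  next
    case (add l A)
    have "heis \<nu> (int k + 1) (mon (add_mset l A)) = mon {#l#} * heis \<nu> (int k + 1) (mon A) +
       (if k = l then of_int (int k + 1) *\<^sub>C mon A else 0)"
      by (simp add: heis_def mon_add_mset[of l A] fock_deriv_var_times cscale_times cscale_add_right
          del: of_int_add of_int_of_nat_eq)
    then have "f (heis \<nu> (int k + 1) (mon (add_mset l A))) = cr l (h (int k + 1) (B A)) +
       (if k = l then of_int (int k + 1) *\<^sub>C B A else 0)"
      by (simp add: f_add f_scale neg f_mon add.IH f_def[of 0] del: of_int_add of_int_of_nat_eq)
    also have "\<dots> = h (int k + 1) (B (add_mset l A))"
      unfolding B_add cr_def by (subst comm[of "int k + 1" "- int l - 1"]) auto
    finally show ?case .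
  qed
  have hom: "f (heis \<nu> n u) = h n (f u)" for n u
  proof -
    consider k where "n = - int k - 1" | "n = 0" | k where "n = int k + 1"
      using that(1)[of "nat (- n - 1)"] that(2) that(3)[of "nat (n - 1)"] by linarith
    then show ?thesis
    proof cases
      case 1
      then show ?thesis using neg by (simp add: heis_def cr_def)
    next
      case 2
      show ?thesis
        by (rule linear_eqI[where u = u])
          (use f_lin in \<open>auto simp: 2 heis_def linear_between_UNIV add scale f_mon zero cscale_add_right
             cscale_cscale mult_ac\<close>)
    next
      case 3
      have "linear_between UNIV UNIV (heis \<nu> n)"
        using heisenberg_rep_heis by (auto simp: heisenberg_rep_def)
      then show ?thesis
        by - (rule linear_eqI[where u = u],
          use f_lin in \<open>auto simp: 3 linear_between_UNIV add scale f_mon pos\<close>)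
    qed
  qed
  show ?thesis
  proof (rule ex1I[of _ f])
    show "linear_between UNIV UNIV f \<and> (\<forall>n u. f (heis \<nu> n u) = h n (f u)) \<and> f 1 = w"
      using f_lin hom f_mon[of "{#}"] by (simp add: B_empty)
  next
    fix g
    assume g: "linear_between UNIV UNIV g \<and> (\<forall>n u. g (heis \<nu> n u) = h n (g u)) \<and> g 1 = w"
    then have g_cr: "g (mon {#k#} * u) = cr k (g u)" for k u
      by (auto simp: cr_def heis_def dest: spec[of _ "- int k - 1"])
    have "g (mon A) = f (mon A)" for A
    proof (induction A)
      case empty
      then show ?case using g using f_mon[of "{#}"] by (simp add: B_empty)
    next
      case (add k A)
      then show ?case by (simp only: mon_add_mset[of k A] g_cr neg)
    qed
    then show "g = f"
      using g f_lin by (intro ext) (rule linear_eqI; simp)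
  qed
qed

text \<open>
  The vertex operator of $h(-k_1-1)\cdots h(-k_r-1)\mathbf 1$ on a level one module is the normally
  ordered product $:\partial^{(k_1)}h(z)\cdots\partial^{(k_r)}h(z):$ of the divided derivatives
  $\partial^{(k)}h(z) = \sum_j \binom{-j-1}{k} h(j) z^{-j-1-k}$, nested to the right, where the $h(j)$
  with $j<0$ stand to the left and those with $j\ge 0$ to the right.
  \<open>normal_product h [k\<^sub>1,\<dots>,k\<^sub>r] n\<close> is its coefficient of $z^{-n-1}$.
\<close>

fun normal_product ::
  "(int \<Rightarrow> 'w::complex_vector \<Rightarrow> 'w) \<Rightarrow> nat list \<Rightarrow> int \<Rightarrow> 'w \<Rightarrow> 'w"
  where
    "normal_product h [] n w = (if n = - 1 then w else 0)"
  | "normal_product h (k # ks) n w = Sum_any (\<lambda>j::int. (of_int (- j - 1) gchoose k) *\<^sub>C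
      (if j < 0 then h j (normal_product h ks (n - j - int k - 1) w)
       else normal_product h ks (n - j - int k - 1) (h j w)))"

text \<open>The order in which the factors of a basis monomial are listed does not matter.\<close>

definition heis_Y :: "(int \<Rightarrow> 'w::complex_vector \<Rightarrow> 'w) \<Rightarrow> fock \<Rightarrow> int \<Rightarrow> 'w \<Rightarrow> 'w"
  where "heis_Y h a n w =
    (\<Sum>A\<in>Poly_Mapping.keys a. Poly_Mapping.lookup a A *\<^sub>C normal_product h (sorted_list_of_multiset A) n w)"

lemma heis_Y_vacuum: "heis_Y h 1 n w = (if n = - 1 then w else 0)"
  by (simp add: heis_Y_def cscale_one flip: single_one)

lemma heis_Y_generator:
  assumes "heisenberg_rep h"
  shows "heis_Y h (heis \<nu> (- 1) 1) n w = h n w"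
proof -
  have h0: "h j 0 = 0" for j
    using assms unfolding heisenberg_rep_def linear_between_UNIV by (metis cvec.scale_zero_left)
  have "(\<lambda>j::int. (of_int (- j - 1) gchoose 0) *\<^sub>C
      (if j < 0 then h j (normal_product h [] (n - j - int 0 - 1) w)
       else normal_product h [] (n - j - int 0 - 1) (h j w))) = (\<lambda>j. if j = n then h n w else 0)"
    by (rule ext) (auto simp: h0 cscale_one)
  then have "normal_product h [0] n w = Sum_any (\<lambda>j. if j = n then h n w else 0)"
    by (simp only: normal_product.simps)
  then show ?thesis
    by (simp add: heis_Y_def heis_def cscale_one)
qed

definition Heis :: "fock voa"
  where "Heis = \<lparr>voa_space = UNIV, voa_Y = heis_Y (heis 0), vacuum = 1,
    conformal = (1 / 2) *\<^sub>C heis 0 (- 1) (heis 0 (- 1) 1)\<rparr>"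

definition theta :: "fock \<Rightarrow> fock"
  where "theta = Poly_Mapping.mapp (\<lambda>A c. (- 1) ^ size A * c)"

definition Heis_plus :: "fock voa"
  where "Heis_plus = Heis \<lparr>voa_space := {a \<in> voa_space Heis. theta a = a}\<rparr>"

text \<open>The $M(1)^+$-modules $M(1)^-$ and $M(1,\lambda)$.\<close>

definition Heis_minus :: "(fock, fock) wmodule"
  where "Heis_minus = \<lparr>space = {a \<in> voa_space Heis. theta a = - a}, act = voa_Y Heis\<rparr>"

definition Fock :: "complex \<Rightarrow> (fock, fock) wmodule"
  where "Fock \<nu> = \<lparr>space = UNIV, act = heis_Y (heis \<nu>)\<rparr>"

end

theory Submission
  imports Defs "HOL-Computational_Algebra.Formal_Power_Series"
begin

text \<open>
  On $M(1,\lambda) \oplus M(1,\lambda)$ let $h(0)$ act by a nontrivial Jordan block and $h(n)$,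
  $n \ne 0$, diagonally.  This is a level one module of the Heisenberg algebra, hence a weak module for
  $M(1)$ and its subalgebra $M(1)^+$, and a self-extension of $M(1,\lambda)$.  For $\lambda = 0$ the map
  $(x,y) \mapsto (-\theta x,\theta y)$ anticommutes with all $h(n)$, so it commutes with
  $M(1)^+$ and its eigenspaces are extensions of $M(1)^\pm$ by $M(1)^\mp$.  None of them splits: on a
  preimage of $e^\lambda$, $\mathbf 1$ and $h(-1)\mathbf 1$, respectively, the operators $L(0)$,
  $L(-1)$ and $L(1)$ have a term linear in the off-diagonal entry of $h(0)$ which no choice of the
  preimage removes.

  That a level one module with truncation is a weak $M(1)$-module, i.e. the Jacobi identity for normally ordered
  products, follows by induction on the monomial $a$: both sides satisfy the same recursion when
  $a$ is replaced by $h(-k-1)a$.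
\<close>

section \<open>Sums of finite support\<close>

text \<open>The only obstruction to moving $h$ through $Y(b,z)$ is the commutator formula, whose
  terms are $Y(h(t)b,z)$ with $t \<ge> 0$, finitely many of them nonzero. A new factor
  $\<partial>^{(k)}h(z_1)$ therefore creates poles $(z_1-z_2)^{-t-k-1}$ against $Y(b,z_2)$: they are
  expanded for $|z_1|>|z_2|$ in one product, for $|z_2|>|z_1|$ in the other, and appear as
  $z_0^{-t-k-1}$ in the iterate. In all three places the correction has coefficient $binom(-t-1,k)$
  up to sign, replaces $b$ by $h(t)b$ and lowers $r$ by $t+k+1$. So the induction must run over all
  $b$ and $r$ at once. The sums over modes are finite only vector by vector, and much of the work is
  to justify their exchange.

  Three different Virasoro modes are needed because the off-diagonal entry of $h(0)^2$ is
  $2\<nu>\<epsilon>$, which is lost for $\<nu>=0$. What then still sees the Jordan block are the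
  terms $h(-1)h(0)$ and $h(0)h(1)$, and these connect opposite parities.\<close>

abbreviation clinear_op :: "('a::complex_vector \<Rightarrow> 'b::complex_vector) \<Rightarrow> bool"
  where "clinear_op \<equiv> linear_between UNIV UNIV"

lemma clinear_op_0: "clinear_op f \<Longrightarrow> f 0 = 0"
  unfolding linear_between_UNIV by (metis cvec.scale_zero_left)

lemma clinear_op_add: "clinear_op f \<Longrightarrow> f (x + y) = f x + f y"
  by (simp add: linear_between_UNIV)

lemma clinear_op_scale: "clinear_op f \<Longrightarrow> f (c *\<^sub>C x) = c *\<^sub>C f x"
  by (simp add: linear_between_UNIV)

lemma clinear_op_sum: "clinear_op f \<Longrightarrow> f (sum g S) = (\<Sum>i\<in>S. f (g i))"
  by (induction S rule: infinite_finite_induct) (simp_all add: clinear_op_0 clinear_op_add)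

lemma clinear_op_Sum_any:
  assumes "clinear_op f" and "finite {i. g i \<noteq> 0}"
  shows "f (Sum_any g) = Sum_any (\<lambda>i. f (g i))"
proof -
  have "Sum_any (\<lambda>i. f (g i)) = (\<Sum>i\<in>{i. g i \<noteq> 0}. f (g i))"
    by (rule Sum_any.expand_superset) (use assms clinear_op_0[OF assms(1)] in auto)
  then show ?thesis
    by (simp add: Sum_any.expand_set[of g] clinear_op_sum[OF assms(1)])
qed

lemma Sum_any_scale: "c *\<^sub>C Sum_any g = Sum_any (\<lambda>i. c *\<^sub>C (g i :: 'a::complex_vector))"
proof (cases "c = 0")
  case True
  then show ?thesis by (simp add: cvec.scale_zero_left)
next
  case False
  then have "{i. c *\<^sub>C g i \<noteq> 0} = {i. g i \<noteq> 0}" by (simp add: cvec.scale_eq_0_iff)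
  then show ?thesis by (simp add: Sum_any.expand_set cvec.scale_sum_right)
qed

lemma Sum_any_add:
  fixes f g :: "'a \<Rightarrow> 'b::ab_group_add"
  shows "finite {i. f i \<noteq> 0} \<Longrightarrow> finite {i. g i \<noteq> 0} \<Longrightarrow>
    Sum_any (\<lambda>i. f i + g i) = Sum_any f + Sum_any g"
  by (rule Sum_any.distrib)

lemma Sum_any_diff:
  fixes f g :: "'a \<Rightarrow> 'b::ab_group_add"
  assumes "finite {i. f i \<noteq> 0}" "finite {i. g i \<noteq> 0}"
  shows "Sum_any (\<lambda>i. f i - g i) = Sum_any f - Sum_any g"
proof -
  have "Sum_any (\<lambda>i. (f i - g i) + g i) = Sum_any (\<lambda>i. f i - g i) + Sum_any g"
    by (rule Sum_any_add) (auto intro: finite_subset[OF _ finite_UnI[OF assms]] assms)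
  then show ?thesis by (simp add: algebra_simps)
qed

lemma Sum_any_sum:
  fixes f :: "'a \<Rightarrow> 'b \<Rightarrow> 'c::ab_group_add"
  assumes "finite S" "\<And>i. i \<in> S \<Longrightarrow> finite {j. f i j \<noteq> 0}"
  shows "finite {j. (\<Sum>i\<in>S. f i j) \<noteq> 0}"
    and "Sum_any (\<lambda>j. \<Sum>i\<in>S. f i j) = (\<Sum>i\<in>S. Sum_any (f i))"
proof -
  have "finite {j. (\<Sum>i\<in>S. f i j) \<noteq> 0} \<and> Sum_any (\<lambda>j. \<Sum>i\<in>S. f i j) = (\<Sum>i\<in>S. Sum_any (f i))"
    using assms
  proof (induction S)
    case (insert x F)
    then have fin: "finite {j. f x j \<noteq> 0}" "finite {j. (\<Sum>i\<in>F. f i j) \<noteq> 0}" by auto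
    have "finite {j. (\<Sum>i\<in>insert x F. f i j) \<noteq> 0}"
      using insert.hyps by (auto intro: finite_subset[OF _ finite_UnI[OF fin]])
    then show ?case using insert by (simp add: Sum_any_add fin)
  qed simp
  then show "finite {j. (\<Sum>i\<in>S. f i j) \<noteq> 0}"
    and "Sum_any (\<lambda>j. \<Sum>i\<in>S. f i j) = (\<Sum>i\<in>S. Sum_any (f i))" by auto
qed

lemma Sum_any_lessThan:
  fixes f :: "nat \<Rightarrow> 'a::comm_monoid_add"
  assumes "\<And>i. i \<ge> N \<Longrightarrow> f i = 0"
  shows "Sum_any f = sum f {..<N}"
  by (rule Sum_any.expand_superset) (use assms not_le in auto)

lemma finite_nat_support: "(\<And>i. i \<ge> N \<Longrightarrow> f i = 0) \<Longrightarrow> finite {i::nat. f i \<noteq> 0}"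
  by (rule finite_subset[of _ "{..<N}"]) (auto simp: not_le[symmetric])

lemma Sum_any_swap:
  fixes g :: "'a \<Rightarrow> 'b \<Rightarrow> 'c::comm_monoid_add"
  assumes "finite {(a, b). g a b \<noteq> 0}"
  shows "Sum_any (\<lambda>a. Sum_any (g a)) = Sum_any (\<lambda>b. Sum_any (\<lambda>a. g a b))"
proof -
  have "finite (fst ` {(a, b). g a b \<noteq> 0} \<times> snd ` {(a, b). g a b \<noteq> 0})"
    using assms by auto
  then show ?thesis
    by (rule Sum_any.swap) force
qed

text \<open>Writing the negative indices as $-m-1$ matches the creation operators $h(-m-1)$ with the
  variables $x_m$.\<close>

lemma Sum_any_int_split:
  fixes g :: "int \<Rightarrow> 'a::ab_group_add"
  assumes "finite {j. g j \<noteq> 0}"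
  shows "Sum_any g = Sum_any (\<lambda>m::nat. g (int m)) + Sum_any (\<lambda>m::nat. g (- int m - 1))"
proof -
  let ?S = "{j. g j \<noteq> 0}"
  have 1: "Sum_any (\<lambda>m::nat. g (int m)) = sum g {j\<in>?S. j \<ge> 0}"
    unfolding Sum_any.expand_set
    by (rule sum.reindex_bij_witness[of _ nat int]) auto
  have 2: "Sum_any (\<lambda>m::nat. g (- int m - 1)) = sum g {j\<in>?S. j < 0}"
    unfolding Sum_any.expand_set
    by (rule sum.reindex_bij_witness[of _ "\<lambda>j. nat (- j - 1)" "\<lambda>m. - int m - 1"]) auto
  have "sum g ?S = sum g {j\<in>?S. j \<ge> 0} + sum g {j\<in>?S. j < 0}"
    using assms by (subst sum.union_disjoint[symmetric]) (auto intro: sum.cong)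
  with 1 2 show ?thesis by (simp add: Sum_any.expand_set[of g])
qed

lemma Sum_any_shift:
  fixes g :: "nat \<Rightarrow> 'a::comm_monoid_add"
  assumes "\<And>i. i < t \<Longrightarrow> g i = 0"
  shows "Sum_any g = Sum_any (\<lambda>l. g (t + l))"
proof -
  have t: "t + (i - t) = i" if "g i \<noteq> 0" for i using assms[of i] that by (cases "i < t") auto
  show ?thesis
    unfolding Sum_any.expand_set
    by (rule sum.reindex_bij_witness[of _ "\<lambda>l. t + l" "\<lambda>i. i - t"]) (auto simp: t)
qed

text \<open>\<open>H\<close> depends only on \<open>i + l\<close>, so the double sum can be grouped
  by antidiagonals, where the coefficients add up by Vandermonde's identity. This is how an
  expansion with exponent \<open>x\<close> absorbs a second one with exponent
  \<open>y\<close>.\<close>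

lemma Sum_any_gchoose_conv:
  fixes H :: "nat \<Rightarrow> 'a::complex_vector"
  assumes "\<And>s. s \<ge> N \<Longrightarrow> H s = 0"
  shows "Sum_any (\<lambda>i. (x gchoose i) *\<^sub>C Sum_any (\<lambda>l. (y gchoose l) *\<^sub>C H (i + l))) =
    Sum_any (\<lambda>s. (x + y gchoose s) *\<^sub>C H s)"
proof -
  have "Sum_any (\<lambda>i. (x gchoose i) *\<^sub>C Sum_any (\<lambda>l. (y gchoose l) *\<^sub>C H (i + l))) =
      (\<Sum>i<N. \<Sum>l<N. ((x gchoose i) * (y gchoose l)) *\<^sub>C H (i + l))"
    by (simp add: Sum_any_lessThan[of N] assms cvec.scale_zero_right cvec.scale_sum_right cscale_cscale)
  also have "\<dots> = (\<Sum>(i, l)\<in>{..<N} \<times> {..<N}. ((x gchoose i) * (y gchoose l)) *\<^sub>C H (i + l))"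
    by (rule sum.cartesian_product)
  also have "\<dots> = (\<Sum>(i, l)\<in>{(i, l). i + l < N}. ((x gchoose i) * (y gchoose l)) *\<^sub>C H (i + l))"
    by (rule sum.mono_neutral_right) (auto simp: cvec.scale_zero_right, metis assms not_le)
  also have "\<dots> = (\<Sum>s<N. \<Sum>i\<le>s. ((x gchoose i) * (y gchoose (s - i))) *\<^sub>C H s)"
    by (subst sum.Sigma) (auto intro!: sum.reindex_bij_witness
        [of _ "\<lambda>(s, i). (i, s - i)" "\<lambda>(i, l). (i + l, i)"])
  also have "\<dots> = (\<Sum>s<N. (x + y gchoose s) *\<^sub>C H s)"
    by (simp add: gbinomial_Vandermonde[symmetric] cvec.scale_sum_left atLeast0AtMost)
  also have "\<dots> = Sum_any (\<lambda>s. (x + y gchoose s) *\<^sub>C H s)"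
    by (simp add: Sum_any_lessThan[of N] assms cvec.scale_zero_right)
  finally show ?thesis .
qed

section \<open>Binomial coefficients\<close>

lemma gchoose_neg_of_nat:
  "(- of_nat n - 1 :: complex) gchoose k = (- 1) ^ k * of_nat (n + k choose k)"
proof -
  have "- of_nat n - 1 = (- (of_nat n + 1) :: complex)" by simp
  then show ?thesis
    using gbinomial_minus[of "of_nat n + 1 :: complex" k]
    by (simp only: binomial_gbinomial of_nat_add) (simp add: add.commute)
qed

text \<open>Both sides are the multinomial coefficient $(t+k+l)!/(t!k!l!)$.\<close>

lemma choose_mult_choose:
  "(t + k + l choose k) * (t + l choose t) = (t + k choose k) * (t + k + l choose l)"
proof -
  have "(t + k + l choose (t + l)) * (t + l choose t) = (t + k + l choose t) * (k + l choose l)"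
    using choose_mult[of t "t + l" "t + k + l"] by (simp add: add.commute add.left_commute)
  moreover have "(t + k + l choose (t + k)) * (t + k choose t) = (t + k + l choose t) * (k + l choose k)"
    using choose_mult[of t "t + k" "t + k + l"] by (simp add: add.commute add.left_commute)
  moreover have "k + l choose l = k + l choose k"
    "t + k + l choose (t + l) = t + k + l choose k" "t + k + l choose (t + k) = t + k + l choose l"
    "t + k choose t = t + k choose k"
    using binomial_symmetric[of l "k + l"] binomial_symmetric[of "t + l" "t + k + l"]
      binomial_symmetric[of "t + k" "t + k + l"] binomial_symmetric[of t "t + k"] by simp_all
  ultimately show ?thesis by (simp add: mult.commute)
qed

text \<open>
  These two identities give the expansions of $\partial_{z_1}^{(k)}(z_1-z_2)^{-t-1} =
  \binom{-t-1}{k}(z_1-z_2)^{-t-k-1}$ for $|z_1|>|z_2|$ and for $|z_2|>|z_1|$.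
\<close>

lemma gchoose_expand_outer:
  "((- of_nat (t + l) - 1 :: complex) gchoose k) * (of_nat (t + l) gchoose t) =
    (- of_nat t - 1 gchoose k) * ((- 1) ^ l * (- of_nat (t + k) - 1 gchoose l))"
proof -
  have "of_nat (t + l + k choose k) * of_nat (t + l choose t) =
      (of_nat (t + k choose k) * of_nat (t + k + l choose l) :: complex)"
    using choose_mult_choose[of t k l] by (simp add: ac_simps flip: of_nat_mult)
  then show ?thesis
    by (simp add: gchoose_neg_of_nat binomial_gbinomial[symmetric] mult.assoc
        flip: power_mult_distrib mult.assoc[of "(- 1) ^ l"] del: of_nat_add)
qed

lemma gchoose_expand_inner:
  "(of_nat (k + l) gchoose k) * ((- of_nat (k + l) - 1 :: complex) gchoose t) =
    (- 1) ^ (t + k) * (- of_nat t - 1 gchoose k) * ((- 1) ^ l * (- of_nat (t + k) - 1 gchoose l))"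
proof -
  have "of_nat (k + l choose k) * of_nat (k + l + t choose t) =
      (of_nat (t + k choose k) * of_nat (t + k + l choose l) :: complex)"
  proof -
    have "(k + l choose k) * (k + l + t choose t) = (k + t choose t) * (t + k + l choose l)"
      using choose_mult_choose[of k t l] by (simp add: ac_simps)
    moreover have "k + t choose t = t + k choose k"
      using binomial_symmetric[of t "k + t"] by (simp add: add.commute)
    ultimately show ?thesis by (simp only: flip: of_nat_mult)
  qed
  then show ?thesis
    by (simp add: gchoose_neg_of_nat binomial_gbinomial[symmetric] mult_ac power_add
        flip: power_mult_distrib del: of_nat_add)
qed

section \<open>Normal ordering\<close>

lemma clinear_op_Sum_any_fun:
  assumes "\<And>i. clinear_op (f i)" and "\<And>u. finite {i. f i u \<noteq> 0}"
  shows "clinear_op (\<lambda>u. Sum_any (\<lambda>i. f i u))"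
  unfolding linear_between_UNIV
  using assms by (simp add: clinear_op_add clinear_op_scale Sum_any_add Sum_any_scale)

definition is_field :: "(int \<Rightarrow> 'w::complex_vector \<Rightarrow> 'w) \<Rightarrow> bool"
  where "is_field A \<longleftrightarrow> (\<forall>n. clinear_op (A n)) \<and> (\<forall>u. \<exists>N. \<forall>n\<ge>N. A n u = 0)"

text \<open>The bound uniform in \<open>i\<close> makes the sum over \<open>i\<close> a field again.
  The finiteness is required for all modes $n \<ge> n_0$ together because normal ordering against
  $h(j)$ with $j<0$ evaluates \<open>F i\<close> at all the modes $n-j>n$.\<close>

definition summable_fields :: "('i \<Rightarrow> int \<Rightarrow> 'w::complex_vector \<Rightarrow> 'w) \<Rightarrow> bool"
  where "summable_fields F \<longleftrightarrow> (\<forall>i n. clinear_op (F i n)) \<and>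
    (\<forall>u. \<exists>N. \<forall>n\<ge>N. \<forall>i. F i n u = 0) \<and> (\<forall>u n0. finite {i. \<exists>n\<ge>n0. F i n u \<noteq> 0})"

lemma summable_fieldsD:
  assumes "summable_fields F"
  shows "clinear_op (F i n)" "finite {i. F i n u \<noteq> 0}"
  using assms unfolding summable_fields_def
  by (blast, auto intro: finite_subset[of _ "{i. \<exists>n'\<ge>n. F i n' u \<noteq> 0}"])

lemma is_field_Sum_any:
  assumes "summable_fields F"
  shows "is_field (\<lambda>n u. Sum_any (\<lambda>i. F i n u))"
  unfolding is_field_def
proof (intro conjI allI)
  show "clinear_op (\<lambda>u. Sum_any (\<lambda>i. F i n u))" for n
    by (rule clinear_op_Sum_any_fun) (use assms in \<open>auto intro: summable_fieldsD\<close>)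
  fix u
  obtain N where "\<forall>n\<ge>N. \<forall>i. F i n u = 0"
    using assms unfolding summable_fields_def by blast
  then show "\<exists>N. \<forall>n\<ge>N. Sum_any (\<lambda>i. F i n u) = 0" by (intro exI[of _ N]) auto
qed

lemma is_field_linear: "is_field A \<Longrightarrow> clinear_op (A n)"
  by (simp add: is_field_def)

lemma is_field_trunc: "is_field A \<Longrightarrow> \<exists>N. \<forall>n\<ge>N. A n u = 0"
  by (simp add: is_field_def)

lemma summable_fields_finite:
  assumes "finite S" "\<And>i. is_field (F i)" "\<And>i n u. i \<notin> S \<Longrightarrow> F i n u = 0"
  shows "summable_fields F"
  unfolding summable_fields_def
proof (intro conjI allI)
  show "clinear_op (F i n)" for i n using assms(2) by (rule is_field_linear)
  show "finite {i. \<exists>n\<ge>n0. F i n u \<noteq> 0}" for u n0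
    by (rule finite_subset[OF _ assms(1)]) (use assms(3) in blast)
  fix u
  have "\<forall>i. \<exists>N. \<forall>n\<ge>N. F i n u = 0" using assms(2) by (simp add: is_field_def)
  then obtain N where N: "\<And>i n. n \<ge> N i \<Longrightarrow> F i n u = 0" by metis
  have "F i n u = 0" if "n \<ge> Max (insert 0 (N ` S))" for i n
    using that N[of i n] assms by (cases "i \<in> S") auto
  then show "\<exists>N. \<forall>n\<ge>N. \<forall>i. F i n u = 0" by blast
qed

lemma is_field_scale: "is_field A \<Longrightarrow> is_field (\<lambda>n u. c *\<^sub>C A n u)"
  unfolding is_field_def
  by (auto simp: linear_between_UNIV cscale_add_right cscale_cscale mult.commute)
    (metis cvec.scale_zero_right)

lemma is_field_zero: "is_field (\<lambda>n u. 0)"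
  by (auto simp: is_field_def linear_between_UNIV)

lemma is_field_add:
  assumes "is_field A" "is_field B"
  shows "is_field (\<lambda>n u. A n u + B n u)"
  unfolding is_field_def
proof (intro conjI allI)
  show "clinear_op (\<lambda>u. A n u + B n u)" for n
    using assms by (simp add: is_field_def linear_between_UNIV cscale_add_right)
  fix u
  obtain M N where "\<forall>n\<ge>M. A n u = 0" "\<forall>n\<ge>N. B n u = 0"
    using assms by (meson is_field_trunc)
  then show "\<exists>N. \<forall>n\<ge>N. A n u + B n u = 0" by (intro exI[of _ "max M N"]) auto
qed

section \<open>Normally ordered products with derivatives of $h(z)$\<close>

locale heisenberg_field =
  fixes h :: "int \<Rightarrow> 'w::complex_vector \<Rightarrow> 'w"
  assumes rep: "heisenberg_rep h" and trunc: "\<exists>N. \<forall>n\<ge>N. h n w = 0"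
begin

lemma h_linear: "clinear_op (h n)"
  using rep by (simp add: heisenberg_rep_def)

lemmas h_simps = clinear_op_0[OF h_linear] clinear_op_add[OF h_linear] clinear_op_scale[OF h_linear]

lemma h_comm: "h m (h n w) = h n (h m w) + (if m = - n then of_int m *\<^sub>C w else 0)"
proof -
  have "h m (h n w) - h n (h m w) = (if m = - n then of_int m *\<^sub>C w else 0)"
    using rep unfolding heisenberg_rep_def by blast
  then show ?thesis by (simp only: diff_eq_eq add.commute)
qed

definition ord :: "int \<Rightarrow> ('w \<Rightarrow> 'w) \<Rightarrow> 'w \<Rightarrow> 'w"
  where "ord j f u = (if j < 0 then h j (f u) else f (h j u))"

lemma ord_linear: "clinear_op f \<Longrightarrow> clinear_op (ord j f)"
  using h_linear[of j] by (auto simp: ord_def linear_between_UNIV)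

text \<open>If exactly one of \<open>i\<close> and \<open>j\<close> is negative, the two operators
  go to different sides of \<open>f\<close>. Otherwise they stand on the same side and commute:
  there $i=-j$ forces $i=j=0$, where the central term vanishes.\<close>

lemma ord_commute: "clinear_op f \<Longrightarrow> ord i (ord j f) u = ord j (ord i f) u"
  using h_comm[of i j] h_comm[of j i] by (auto simp: ord_def clinear_op_0 cvec.scale_zero_left)

lemma ord_zero: "(\<And>u. f u = 0) \<Longrightarrow> ord j f u = 0"
  by (simp add: ord_def h_simps)

lemma ord_scale: "ord j (\<lambda>u. c *\<^sub>C f u) u = c *\<^sub>C ord j f u"
  by (simp add: ord_def h_simps)

lemma ord_sum: "ord j (\<lambda>u. \<Sum>i\<in>S. f i u) u = (\<Sum>i\<in>S. ord j (f i) u)"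
  by (simp add: ord_def clinear_op_sum[OF h_linear])

text \<open>For $j<0$ the uniform truncation of \<open>F\<close> bounds \<open>j\<close> from below,
  and the finiteness over all modes above \<open>n\<close> bounds \<open>i\<close>. For $j \<ge> 0$
  truncation of \<open>h\<close> on \<open>u\<close> leaves finitely many \<open>j\<close>, each
  with its own vector \<open>h j u\<close> and finitely many \<open>i\<close>. Joint finiteness in
  both indices is what permits exchanging the sums.\<close>

lemma finite_ord_support:
  assumes F: "summable_fields F"
  shows "finite {(i, j). ord j (F i (n - j)) u \<noteq> 0}"
proof -
  obtain N where N: "\<And>n i. n \<ge> N \<Longrightarrow> F i n u = 0"
    using F unfolding summable_fields_def by metis
  obtain J where J: "\<And>n. n \<ge> J \<Longrightarrow> h n u = 0"
    using trunc by metis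
  have fin: "finite {i. \<exists>n\<ge>n0. F i n v \<noteq> 0}" for v n0
    using F unfolding summable_fields_def by blast
  have F0: "F i m 0 = 0" for i m
    using summable_fieldsD(1)[OF F] by (rule clinear_op_0)
  let ?L = "{i. \<exists>m\<ge>n. F i m u \<noteq> 0} \<times> {n - N..0}"
  let ?R = "\<Union>j\<in>{0..J}. {i. \<exists>m\<ge>n - j. F i m (h j u) \<noteq> 0} \<times> {j}"
  have "(i, j) \<in> ?L \<union> ?R" if *: "ord j (F i (n - j)) u \<noteq> 0" for i j
  proof (cases "j < 0")
    case True
    with * have "F i (n - j) u \<noteq> 0" by (auto simp: ord_def h_simps)
    moreover from this have "n - j < N" using N not_le by metis
    ultimately show ?thesis
      using True by (auto intro!: exI[of _ "n - j"])
  next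
    case False
    with * have "F i (n - j) (h j u) \<noteq> 0" by (simp add: ord_def)
    moreover from this have "j \<le> J" using J[of j] F0 by (metis linear)
    ultimately show ?thesis using False by auto
  qed
  then have "{(i, j). ord j (F i (n - j)) u \<noteq> 0} \<subseteq> ?L \<union> ?R" by blast
  moreover have "finite (?L \<union> ?R)"
    using fin by simp
  ultimately show ?thesis by (rule finite_subset)
qed

text \<open>The modes of $:\<partial>^{(k)}h(z)A(z):$. As an operation on arbitrary fields it
  applies not only to vertex operators but also to the two products and the iterate of the Jacobi
  identity, regarded as fields in the index \<open>p\<close>.\<close>

definition nop :: "nat \<Rightarrow> (int \<Rightarrow> 'w \<Rightarrow> 'w) \<Rightarrow> int \<Rightarrow> 'w \<Rightarrow> 'w"
  where "nop k A n u =
    Sum_any (\<lambda>j::int. (of_int (- j - 1) gchoose k) *\<^sub>C ord j (A (n - j - int k - 1)) u)"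

lemma finite_nop_family:
  assumes "summable_fields F"
  shows "finite {(i, j). c i j *\<^sub>C ord j (F i (n - j - int k - 1)) u \<noteq> 0}"
  by (rule finite_subset[OF _ finite_ord_support[OF assms, of "n - int k - 1" u]])
    (auto simp: algebra_simps cvec.scale_zero_right)

lemma summable_fields_const: "is_field A \<Longrightarrow> summable_fields (\<lambda>_::unit. A)"
  by (rule summable_fields_finite) auto

lemma finite_nop:
  assumes "is_field A"
  shows "finite {j. c j *\<^sub>C ord j (A (n - j - int k - 1)) u \<noteq> 0}"
proof -
  have "finite (snd ` {(i::unit, j). c j *\<^sub>C ord j (A (n - j - int k - 1)) u \<noteq> 0})"
    using finite_nop_family[OF summable_fields_const[OF assms], of "\<lambda>_. c" n k u] by (rule finite_imageI)
  then show ?thesis by (rule rev_finite_subset) force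
qed

lemma nop_Sum_any:
  assumes F: "summable_fields F"
  shows "nop k (\<lambda>n u. Sum_any (\<lambda>i. F i n u)) n u = Sum_any (\<lambda>i. nop k (F i) n u)"
proof -
  let ?c = "\<lambda>j::int. of_int (- j - 1) gchoose k"
  have "ord j (\<lambda>u. Sum_any (\<lambda>i. F i m u)) u = Sum_any (\<lambda>i. ord j (F i m) u)" for j m
    by (simp add: ord_def clinear_op_Sum_any[OF h_linear] summable_fieldsD[OF F])
  then have "nop k (\<lambda>n u. Sum_any (\<lambda>i. F i n u)) n u =
      Sum_any (\<lambda>j. Sum_any (\<lambda>i. ?c j *\<^sub>C ord j (F i (n - j - int k - 1)) u))"
    by (simp add: nop_def Sum_any_scale)
  also have "\<dots> = Sum_any (\<lambda>i. Sum_any (\<lambda>j. ?c j *\<^sub>C ord j (F i (n - j - int k - 1)) u))"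
    by (rule Sum_any_swap[symmetric]) (rule finite_nop_family[OF F])
  finally show ?thesis by (simp add: nop_def)
qed

lemma finite_nop_Sum_any:
  assumes F: "summable_fields F"
  shows "finite {i. nop k (F i) n u \<noteq> 0}"
proof -
  let ?g = "\<lambda>i j. (of_int (- j - 1) gchoose k) *\<^sub>C ord j (F i (n - j - int k - 1)) u"
  have "nop k (F i) n u = 0" if "\<And>j. ?g i j = 0" for i
    unfolding nop_def by (subst that) simp
  then have "{i. nop k (F i) n u \<noteq> 0} \<subseteq> fst ` {(i, j). ?g i j \<noteq> 0}" by force
  then show ?thesis by (rule finite_subset) (rule finite_imageI, rule finite_nop_family[OF F])
qed

text \<open>This makes a normally ordered product a summable family over \<open>j\<close>, so that a
  second one can be taken term by term.\<close>

lemma summable_fields_ord: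
  assumes A: "is_field A"
  shows "summable_fields (\<lambda>j n u. c j *\<^sub>C ord j (A (n - j - int k - 1)) u)"
  unfolding summable_fields_def
proof (intro conjI allI)
  show "clinear_op (\<lambda>u. c j *\<^sub>C ord j (A (n - j - int k - 1)) u)" for j n
    using ord_linear[OF is_field_linear[OF A, of "n - j - int k - 1"], of j]
    by (simp add: linear_between_UNIV cscale_add_right cscale_cscale mult.commute)
  fix u
  obtain N where N: "\<And>n. n \<ge> N \<Longrightarrow> A n u = 0" using is_field_trunc[OF A] by metis
  obtain J where J: "\<And>n. n \<ge> J \<Longrightarrow> h n u = 0" using trunc by metis
  have A0: "A n 0 = 0" for n using clinear_op_0[OF is_field_linear[OF A]] .
  have "\<forall>v. \<exists>N. \<forall>n\<ge>N. A n v = 0" using is_field_trunc[OF A] by blast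
  then obtain M where M: "\<And>v n. n \<ge> M v \<Longrightarrow> A n v = 0" by metis
  \<comment> \<open>The truncation bound of \<open>A\<close> depends on the vector, but only
    \<open>u\<close> and the finitely many \<open>h j u\<close> with $0 \<le> j \<le> J$ matter;
    \<open>K\<close> dominates all their bounds.\<close>
  define K where "K = Max (insert N ((\<lambda>j. M (h j u)) ` {0..J}))"
  have K: "K \<ge> N" "\<And>j. j \<in> {0..J} \<Longrightarrow> K \<ge> M (h j u)" unfolding K_def by (rule Max_ge; simp)+
  have "ord j (A (n - j - int k - 1)) u = 0" if "n \<ge> K + \<bar>J\<bar> + int k + 1" for n j
  proof -
    consider "j < 0" | "j > J" "j \<ge> 0" | "j \<in> {0..J}" by fastforce
    then show ?thesis
    proof cases
      case 1 then show ?thesis using that K(1) by (simp add: ord_def N h_simps)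
    next
      case 2 then show ?thesis by (simp add: ord_def J A0)
    next
      case 3
      then show ?thesis using that K(2)[OF 3] by (simp add: ord_def M)
    qed
  qed
  then show "\<exists>N. \<forall>n\<ge>N. \<forall>j. c j *\<^sub>C ord j (A (n - j - int k - 1)) u = 0"
    by (intro exI[of _ "K + \<bar>J\<bar> + int k + 1"]) (auto simp: cvec.scale_zero_right)
  fix n0
  have "{j. \<exists>n\<ge>n0. c j *\<^sub>C ord j (A (n - j - int k - 1)) u \<noteq> 0} \<subseteq> {min 0 (n0 - N - int k - 1)..\<bar>J\<bar>}"
  proof clarify
    fix j n
    assume *: "n0 \<le> n" "c j *\<^sub>C ord j (A (n - j - int k - 1)) u \<noteq> 0"
    show "j \<in> {min 0 (n0 - N - int k - 1)..\<bar>J\<bar>}"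
    proof (cases "j < 0")
      case True
      then have "A (n - j - int k - 1) u \<noteq> 0" using *(2) by (auto simp: ord_def h_simps cvec.scale_zero_right)
      then have "n - j - int k - 1 < N" using N not_le by metis
      then show ?thesis using * True by auto
    next
      case False
      then have "h j u \<noteq> 0" using *(2) by (auto simp: ord_def A0 cvec.scale_zero_right)
      then have "j < J" using J not_le by metis
      then show ?thesis using False by auto
    qed
  qed
  then show "finite {j. \<exists>n\<ge>n0. c j *\<^sub>C ord j (A (n - j - int k - 1)) u \<noteq> 0}"
    by (rule finite_subset) simp
qed

lemma is_field_nop: "is_field A \<Longrightarrow> is_field (nop k A)"
  using is_field_Sum_any[OF summable_fields_ord] by (simp add: nop_def[abs_def])

text \<open>Both sides are the same double sum of nested \<open>ord\<close> terms, by
  \<open>ord_commute\<close> and an exchange of sums. Hence the vertex operator of a monomial does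
  not depend on the order of its factors.\<close>

lemma nop_commute:
  assumes A: "is_field A"
  shows "nop k (nop l A) n u = nop l (nop k A) n u"
proof -
  let ?c = "\<lambda>j k. of_int (- j - 1) gchoose k :: complex"
  let ?F = "\<lambda>l j n u. ?c j l *\<^sub>C ord j (A (n - j - int l - 1)) u"
  have F: "summable_fields (?F l)" for l by (rule summable_fields_ord[OF A])
  have lin: "clinear_op (A n)" for n using A by (rule is_field_linear)
  have expand: "nop k (nop l A) n u = Sum_any (\<lambda>j. Sum_any (\<lambda>i. ?c i k *\<^sub>C ord i (?F l j (n - i - int k - 1)) u))"
    for k l
  proof -
    have "nop k (nop l A) n u = Sum_any (\<lambda>j. nop k (?F l j) n u)"
      using nop_Sum_any[OF F[of l], of k n u] by (simp add: nop_def[of l, abs_def])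
    then show ?thesis by (simp add: nop_def)
  qed
  have "nop k (nop l A) n u = Sum_any (\<lambda>i. Sum_any (\<lambda>j. ?c i k *\<^sub>C ord i (?F l j (n - i - int k - 1)) u))"
    unfolding expand by (rule Sum_any_swap) (rule finite_nop_family[OF F])
  moreover have "?c i k *\<^sub>C ord i (?F l j (n - i - int k - 1)) u =
      ?c j l *\<^sub>C ord j (?F k i (n - j - int l - 1)) u" for i j
    using ord_commute[OF lin, of i j "n - i - int k - 1 - j - int l - 1" u]
    by (simp add: ord_scale cscale_cscale mult.commute algebra_simps)
  then have "Sum_any (\<lambda>i. Sum_any (\<lambda>j. ?c i k *\<^sub>C ord i (?F l j (n - i - int k - 1)) u)) =
      nop l (nop k A) n u"
    unfolding expand by simp
  ultimately show ?thesis by simp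
qed

end


lemma is_field_sum: "(\<And>i. i \<in> S \<Longrightarrow> is_field (F i)) \<Longrightarrow> is_field (\<lambda>n u. \<Sum>i\<in>S. F i n u)"
  by (induction S rule: infinite_finite_induct) (simp_all add: is_field_zero is_field_add)

section \<open>Linearity of vertex operators in the state, and truncation on Fock modules\<close>

lemma linear_heis_Y: "clinear_op (\<lambda>a. heis_Y h a n w)"
proof -
  let ?B = "\<lambda>A. normal_product h (sorted_list_of_multiset A) n w"
  have super: "heis_Y h a n w = (\<Sum>A\<in>S. Poly_Mapping.lookup a A *\<^sub>C ?B A)"
    if "finite S" "Poly_Mapping.keys a \<subseteq> S" for a S
    unfolding heis_Y_def
    using that by (intro sum.mono_neutral_left) (auto simp: in_keys_iff cvec.scale_zero_left)
  show ?thesis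
    unfolding linear_between_UNIV
  proof (intro conjI allI)
    fix x y :: fock and c
    let ?S = "Poly_Mapping.keys x \<union> Poly_Mapping.keys y"
    show "heis_Y h (x + y) n w = heis_Y h x n w + heis_Y h y n w"
      using Poly_Mapping.keys_add[of x y]
      by (simp add: super[of ?S] lookup_add cvec.scale_left_distrib sum.distrib)
    have "Poly_Mapping.keys (c *\<^sub>C x) \<subseteq> Poly_Mapping.keys x"
      by (auto simp: in_keys_iff cscale_complex_def)
    then show "heis_Y h (c *\<^sub>C x) n w = c *\<^sub>C heis_Y h x n w"
      by (simp add: super[of "Poly_Mapping.keys x"] cvec.scale_sum_right cscale_cscale cscale_complex_def)
  qed
qed

lemmas heis_Y_add = clinear_op_add[OF linear_heis_Y]
  and heis_Y_scale = clinear_op_scale[OF linear_heis_Y]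
  and heis_Y_0 = clinear_op_0[OF linear_heis_Y]

lemma heis_Y_mon: "heis_Y h (mon A) n w = normal_product h (sorted_list_of_multiset A) n w"
  by (simp add: heis_Y_def cscale_one)

text \<open>Only finitely many variables occur in \<open>u\<close>, and the derivatives in all
  others vanish.\<close>

lemma heis_trunc: "\<exists>N. \<forall>n\<ge>N. heis \<nu> n u = 0"
proof -
  let ?K = "\<Union>A\<in>Poly_Mapping.keys u. set_mset A"
  have fin: "finite ?K" by simp
  have zero: "fock_deriv k u = 0" if "k \<notin> ?K" for k
  proof (rule poly_mapping_eqI)
    fix A
    have "add_mset k A \<notin> Poly_Mapping.keys u" using that by auto
    then show "Poly_Mapping.lookup (fock_deriv k u) A = Poly_Mapping.lookup 0 A"
      by (simp add: lookup_fock_deriv in_keys_iff)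
  qed
  obtain M where M: "\<And>k. k \<in> ?K \<Longrightarrow> k \<le> M"
    using finite_nat_set_iff_bounded_le[of ?K] fin by auto
  have "heis \<nu> n u = 0" if "n \<ge> int M + 2" for n
  proof -
    have "nat (n - 1) \<notin> ?K"
    proof
      assume "nat (n - 1) \<in> ?K"
      from M[OF this] show False using that by simp
    qed
    then show ?thesis using that zero by (simp add: heis_def cvec.scale_zero_right)
  qed
  then show ?thesis by blast
qed

lemma heisenberg_field_heis: "heisenberg_field (heis \<nu>)"
  by unfold_locales (rule heisenberg_rep_heis heis_trunc)+

interpretation V: heisenberg_field "heis 0"
  by (rule heisenberg_field_heis)

lemma heis_var_times:
  "n \<ge> 0 \<Longrightarrow> heis 0 n (mon {#l#} * c) = mon {#l#} * heis 0 n c + (if n = int l + 1 then of_int n *\<^sub>C c else 0)"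
  using V.h_comm[of n "- int l - 1" c] by (auto simp: heis_def)

section \<open>Recursion over the factors of a state, and commutators with $h(m)$\<close>

context heisenberg_field
begin

lemma nop_add:
  assumes "is_field A" "is_field B"
  shows "nop k (\<lambda>n u. A n u + B n u) n u = nop k A n u + nop k B n u"
proof -
  have "ord j (\<lambda>u. A m u + B m u) u = ord j (A m) u + ord j (B m) u" for j m
    by (simp add: ord_def h_simps)
  then show ?thesis
    by (simp only: nop_def cscale_add_right) (rule Sum_any_add; rule finite_nop; rule assms)
qed

lemma nop_scale_shift: "nop k (\<lambda>n u. c *\<^sub>C A (n + d) u) n u = c *\<^sub>C nop k A (n + d) u"
  by (simp add: nop_def Sum_any_scale ord_scale cscale_cscale mult.commute algebra_simps)

lemma nop_scale: "nop k (\<lambda>n u. c *\<^sub>C A n u) n u = c *\<^sub>C nop k A n u"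
  using nop_scale_shift[of k c A 0] by simp

lemma normal_product_Cons: "normal_product h (k # ks) = nop k (normal_product h ks)"
  by (intro ext) (simp add: nop_def ord_def if_distrib cong: if_cong)

lemma is_field_normal_product: "is_field (normal_product h ks)"
proof (induction ks)
  case Nil
  have "\<exists>N. \<forall>n\<ge>N. normal_product h [] n u = 0" for u by (intro exI[of _ 0]) auto
  then show ?case
    by (auto simp: is_field_def linear_between_UNIV cvec.scale_zero_right)
next
  case (Cons k ks)
  then show ?case by (simp only: normal_product_Cons is_field_nop)
qed

text \<open>By \<open>nop_commute\<close> the new factor can be moved past the smaller entries, so
  sorting does not disturb the recursion.\<close>

lemma normal_product_insort: "normal_product h (insort k ks) = nop k (normal_product h ks)"
proof (induction ks)
  case Nil
  show ?case by (simp only: insort_key.simps normal_product_Cons)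
next
  case (Cons x ks)
  have "nop x (nop k (normal_product h ks)) = nop k (nop x (normal_product h ks))"
    by (intro ext nop_commute is_field_normal_product)
  then show ?case
    by (auto simp: Cons normal_product_Cons simp del: normal_product.simps)
qed

lemma is_field_heis_Y: "is_field (heis_Y h a)"
  unfolding heis_Y_def[abs_def]
  by (intro is_field_sum is_field_scale is_field_normal_product)

lemma heis_Y_mon_add_mset: "heis_Y h (mon (add_mset k A)) = nop k (heis_Y h (mon A))"
  by (simp only: heis_Y_mon[abs_def] sorted_list_of_multiset_insert normal_product_insort)

lemma heis_Y_var_times: "heis_Y h (mon {#k#} * a) = nop k (heis_Y h a)"
proof (intro ext)
  fix n u
  show "heis_Y h (mon {#k#} * a) n u = nop k (heis_Y h a) n u"
  proof (rule linear_eqI[where u = a], goal_cases)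
    case 1
    show ?case by (simp add: linear_between_UNIV distrib_left cscale_times heis_Y_add heis_Y_scale)
  next
    case 2
    show ?case
      by (simp add: linear_between_UNIV heis_Y_add[abs_def] heis_Y_scale[abs_def]
          nop_add nop_scale is_field_heis_Y)
  next
    case (3 A)
    show ?case by (simp only: mon_add_mset[symmetric] heis_Y_mon_add_mset)
  qed
qed

lemma finite_heis_modes: "finite {t::nat. c t *\<^sub>C heis_Y h (heis 0 (int t) b) (f t) u \<noteq> 0}"
proof -
  obtain N where "\<And>n. n \<ge> N \<Longrightarrow> heis 0 n b = 0" using heis_trunc by metis
  then have "c t *\<^sub>C heis_Y h (heis 0 (int t) b) (f t) u = 0" if "t \<ge> nat N" for t
    using that by (simp add: heis_Y_0 cvec.scale_zero_right)
  then show ?thesis by (rule finite_nat_support)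
qed

text \<open>The bracket with $h(m)$ is a derivation: applied to \<open>f\<close> it gives the middle
  term, applied to \<open>h j\<close> the central term.\<close>

lemma h_ord:
  assumes "clinear_op f"
  shows "h m (ord j f u) = ord j f (h m u) + ord j (\<lambda>u. h m (f u) - f (h m u)) u +
    (if j = - m then of_int m *\<^sub>C f u else 0)"
proof -
  have minus: "h i (x - y) = h i x - h i y" for i x y
    using h_simps(2)[of i "x - y" y] by simp
  show ?thesis
    using h_comm[of m j "f u"] h_comm[of m j u] assms
    by (auto simp: ord_def minus clinear_op_add clinear_op_scale)
qed

lemma h_nop:
  assumes A: "is_field A" and D: "is_field D" and AD: "\<And>n u. h m (A n u) = A n (h m u) + D n u"
  shows "h m (nop l A n u) = nop l A n (h m u) + nop l D n u +
    (of_int (m - 1) gchoose l) *\<^sub>C of_int m *\<^sub>C A (n + m - int l - 1) u"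
proof -
  let ?c = "\<lambda>j::int. of_int (- j - 1) gchoose l :: complex" and ?d = "\<lambda>j. n - j - int l - 1"
  have "(\<lambda>u. h m (A k u) - A k (h m u)) = D k" for k
    by (simp add: AD)
  then have "h m (nop l A n u) = Sum_any (\<lambda>j. (?c j *\<^sub>C ord j (A (?d j)) (h m u) + ?c j *\<^sub>C ord j (D (?d j)) u) +
      (if j = - m then ?c j *\<^sub>C of_int m *\<^sub>C A (?d j) u else 0))"
    unfolding nop_def clinear_op_Sum_any[OF h_linear finite_nop[OF A]] h_simps(3)
      h_ord[OF is_field_linear[OF A]]
    by (simp add: cscale_add_right if_distrib cvec.scale_zero_right cong: if_cong)
  also have "\<dots> = Sum_any (\<lambda>j. ?c j *\<^sub>C ord j (A (?d j)) (h m u)) + Sum_any (\<lambda>j. ?c j *\<^sub>C ord j (D (?d j)) u) +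
      Sum_any (\<lambda>j. if j = - m then ?c j *\<^sub>C of_int m *\<^sub>C A (?d j) u else 0)"
  proof (subst Sum_any_add)
    show "finite {j. ?c j *\<^sub>C ord j (A (?d j)) (h m u) + ?c j *\<^sub>C ord j (D (?d j)) u \<noteq> 0}"
      by (rule finite_subset[OF _ finite_UnI[OF finite_nop[OF A, of ?c n l "h m u"] finite_nop[OF D, of ?c n l u]]]) auto
    show "finite {j. (if j = - m then ?c j *\<^sub>C of_int m *\<^sub>C A (?d j) u else 0) \<noteq> 0}"
      by (rule finite_subset[of _ "{- m}"]) auto
  qed (simp only: Sum_any_add[OF finite_nop[OF A] finite_nop[OF D]])
  also have "Sum_any (\<lambda>j. if j = - m then ?c j *\<^sub>C of_int m *\<^sub>C A (?d j) u else 0) =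
      ?c (- m) *\<^sub>C of_int m *\<^sub>C A (?d (- m)) u"
    by (subst Sum_any.expand_superset[of "{- m}"]) auto
  finally show ?thesis by (simp add: nop_def algebra_simps)
qed

text \<open>The commutator formula for the generator, that is, the Jacobi identity for $a=h(-1)1$
  and $r=0$. It is proved by itself because every correction term in the recursions for general $a$
  comes from it.\<close>

lemma h_heis_Y:
  "h m (heis_Y h b n u) = heis_Y h b n (h m u) +
    Sum_any (\<lambda>t::nat. (of_int m gchoose t) *\<^sub>C heis_Y h (heis 0 (int t) b) (m + n - int t) u)"
proof -
  let ?D = "\<lambda>b n u. Sum_any (\<lambda>t::nat. (of_int m gchoose t) *\<^sub>C heis_Y h (heis 0 (int t) b) (m + n - int t) u)"
  have Dlin: "clinear_op (\<lambda>b. ?D b n u)" for n u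
  proof (rule clinear_op_Sum_any_fun)
    show "clinear_op (\<lambda>b. (of_int m gchoose t) *\<^sub>C heis_Y h (heis 0 (int t) b) (m + n - int t) u)" for t :: nat
      by (simp add: linear_between_UNIV V.h_simps heis_Y_add heis_Y_scale cscale_add_right
          cscale_cscale mult.commute)
  qed (rule finite_heis_modes)
  have mon: "h m (heis_Y h (mon B) n u) = heis_Y h (mon B) n (h m u) + ?D (mon B) n u" for B n u
  proof (induction B arbitrary: n u)
    case empty
    have "heis 0 (int t) (mon {#}) = 0" for t
      by (simp add: heis_vacuum cvec.scale_zero_left)
    then show ?case
      by (auto simp: heis_Y_vacuum heis_Y_0 cvec.scale_zero_right h_simps)
  next
    case (add l B)
    let ?F = "\<lambda>t n u. (of_int m gchoose t) *\<^sub>C heis_Y h (heis 0 (int t) (mon B)) (m + n - int t) u"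
    have F: "summable_fields ?F"
    proof -
      obtain N where N: "\<And>n. n \<ge> N \<Longrightarrow> heis 0 n (mon B) = 0" using heis_trunc by metis
      show ?thesis
      proof (rule summable_fields_finite[of "{..<nat N}"])
        fix t
        obtain d where d: "d = m - int t" by simp
        have "\<exists>N. \<forall>n\<ge>N. heis_Y h (heis 0 (int t) (mon B)) (m + n - int t) u = 0" for u
        proof -
          obtain N where "\<forall>n\<ge>N. heis_Y h (heis 0 (int t) (mon B)) n u = 0"
            using is_field_trunc[OF is_field_heis_Y] by blast
          then show ?thesis by (intro exI[of _ "N - m + int t"]) auto
        qed
        then show "is_field (?F t)"
          by (intro is_field_scale) (simp add: is_field_def is_field_linear[OF is_field_heis_Y])
      qed (auto simp: N heis_Y_0 cvec.scale_zero_right)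
    qed
    have "h m (heis_Y h (mon (add_mset l B)) n u) = heis_Y h (mon (add_mset l B)) n (h m u) +
        nop l (?D (mon B)) n u + (of_int (m - 1) gchoose l) *\<^sub>C of_int m *\<^sub>C heis_Y h (mon B) (n + m - int l - 1) u"
      unfolding heis_Y_mon_add_mset
      by (rule h_nop) (simp_all only: is_field_heis_Y is_field_Sum_any[OF F] add.IH)
    also have "nop l (?D (mon B)) n u = Sum_any (\<lambda>t. (of_int m gchoose t) *\<^sub>C
        heis_Y h (mon {#l#} * heis 0 (int t) (mon B)) (m + n - int t) u)"
    proof -
      have "nop l (?F t) n u = (of_int m gchoose t) *\<^sub>C
          heis_Y h (mon {#l#} * heis 0 (int t) (mon B)) (m + n - int t) u" for t
        using nop_scale_shift[of l "of_int m gchoose t" "heis_Y h (heis 0 (int t) (mon B))" "m - int t" n u]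
        by (simp add: heis_Y_var_times algebra_simps)
      then show ?thesis by (simp only: nop_Sum_any[OF F])
    qed
    \<comment> \<open>The central term of \<open>h_nop\<close> is the contraction of $h(l+1)$ with
      the new variable $x_l$, so it belongs to $t=l+1$. The coefficients agree by absorption: $m
      binom(m-1,l) = (l+1) binom(m,l+1)$.\<close>
    also have "(of_int (m - 1) gchoose l) *\<^sub>C of_int m *\<^sub>C heis_Y h (mon B) (n + m - int l - 1) u =
      Sum_any (\<lambda>t. if t = l + 1 then (of_int m gchoose t) *\<^sub>C of_nat t *\<^sub>C heis_Y h (mon B) (m + n - int t) u else 0)"
    proof -
      have *: "(of_int (m - 1) gchoose l) * of_int m = (of_int m gchoose (l + 1)) * (of_nat (l + 1) :: complex)"
        using gbinomial_absorption[of l "of_int m :: complex"] by (simp add: mult.commute)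
      have e: "n + m - int l - 1 = m + n - int (l + 1)" by simp
      have "Sum_any (\<lambda>t. if t = l + 1 then (of_int m gchoose t) *\<^sub>C of_nat t *\<^sub>C heis_Y h (mon B) (m + n - int t) u else 0) =
          (of_int m gchoose (l + 1)) *\<^sub>C of_nat (l + 1) *\<^sub>C heis_Y h (mon B) (m + n - int (l + 1)) u"
        by (subst Sum_any.expand_superset[of "{l + 1}"]) (simp_all del: of_nat_add of_nat_Suc add: subset_iff)
      then show ?thesis unfolding cscale_cscale * e by (rule sym)
    qed
    also have "heis_Y h (mon (add_mset l B)) n (h m u) + Sum_any (\<lambda>t. (of_int m gchoose t) *\<^sub>C
        heis_Y h (mon {#l#} * heis 0 (int t) (mon B)) (m + n - int t) u) +
      Sum_any (\<lambda>t. if t = l + 1 then (of_int m gchoose t) *\<^sub>C of_nat t *\<^sub>C heis_Y h (mon B) (m + n - int t) u else 0) =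
      heis_Y h (mon (add_mset l B)) n (h m u) + ?D (mon (add_mset l B)) n u"
    proof -
      have *: "(of_int m gchoose t) *\<^sub>C heis_Y h (heis 0 (int t) (mon (add_mset l B))) (m + n - int t) u =
        (of_int m gchoose t) *\<^sub>C heis_Y h (mon {#l#} * heis 0 (int t) (mon B)) (m + n - int t) u +
        (if t = l + 1 then (of_int m gchoose t) *\<^sub>C of_nat t *\<^sub>C heis_Y h (mon B) (m + n - int t) u else 0)" for t
        by (simp add: mon_add_mset[of l B] heis_var_times heis_Y_add heis_Y_scale cscale_add_right heis_Y_0
            cvec.scale_zero_right)
      have fin: "finite {t. (if t = l + 1 then (of_int m gchoose t) *\<^sub>C of_nat t *\<^sub>C heis_Y h (mon B) (m + n - int t) u else 0) \<noteq> 0}"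
        by (rule finite_subset[of _ "{l + 1}"]) auto
      have fin': "finite {t. (of_int m gchoose t) *\<^sub>C heis_Y h (mon {#l#} * heis 0 (int t) (mon B)) (m + n - int t) u \<noteq> 0}"
        by (rule finite_subset[OF _ finite_UnI[OF fin finite_heis_modes[of "\<lambda>t. of_int m gchoose t" "mon (add_mset l B)" "\<lambda>t. m + n - int t" u]]])
          (auto simp: *)
      show ?thesis by (simp only: * Sum_any_add[OF fin' fin] add.assoc)
    qed
    finally show ?case .
  qed
  show ?thesis
  proof (rule linear_eqI[where u = b], goal_cases)
    case 1
    show ?case by (simp add: linear_between_UNIV h_simps heis_Y_add heis_Y_scale)
  next
    case 2
    show ?case
      unfolding linear_between_UNIV heis_Y_add heis_Y_scale clinear_op_add[OF Dlin] clinear_op_scale[OF Dlin]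
      by (simp add: cscale_add_right)
  qed (rule mon)
qed

end


section \<open>The Jacobi identity\<close>

lemma is_field_comp_right:
  "is_field A \<Longrightarrow> clinear_op g \<Longrightarrow> is_field (\<lambda>n u. A n (g u))"
  by (simp add: is_field_def linear_between_UNIV)

lemma is_field_comp_left:
  assumes "is_field A" "clinear_op g"
  shows "is_field (\<lambda>n u. g (A n u))"
proof -
  have "\<exists>N. \<forall>n\<ge>N. g (A n u) = 0" for u
    using is_field_trunc[OF assms(1), of u] clinear_op_0[OF assms(2)] by metis
  then show ?thesis using assms by (simp add: is_field_def linear_between_UNIV)
qed

text \<open>
  The modes of the two products $Y(a,z_1)Y(b,z_2)$ and $Y(b,z_2)Y(a,z_1)$ in the Jacobi identity are
  \<open>mode_product A B r q p\<close> and \<open>(- 1) powi r *\<^sub>C mode_product B A r p q\<close>; the argument to which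
  \<open>nop\<close> applies comes last.
\<close>

definition mode_product ::
  "(int \<Rightarrow> 'w::complex_vector \<Rightarrow> 'w) \<Rightarrow> (int \<Rightarrow> 'w \<Rightarrow> 'w) \<Rightarrow> int \<Rightarrow> int \<Rightarrow> int \<Rightarrow> 'w \<Rightarrow> 'w"
  where "mode_product A B r q p u =
    Sum_any (\<lambda>i::nat. ((- 1) ^ i * (of_int r gchoose i)) *\<^sub>C A (p + r - int i) (B (q + int i) u))"

text \<open>The field index is \<open>p\<close>, the mode of \<open>A\<close>, in both parts. With
  \<open>A\<close> outside, truncation of \<open>B\<close> on \<open>u\<close> bounds
  \<open>i\<close> independently of \<open>p\<close>; with \<open>A\<close> inside, truncation of
  \<open>A\<close> on \<open>u\<close> bounds \<open>i\<close> once \<open>p\<close> is bounded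
  below.\<close>

lemma summable_fields_mode_product:
  assumes A: "is_field A" and B: "is_field B"
  shows "summable_fields (\<lambda>i p u. c i *\<^sub>C A (p + r - int i) (B (q + int i) u))"
    and "summable_fields (\<lambda>i p u. c i *\<^sub>C B (q + r - int i) (A (p + int i) u))"
proof -
  note lin = is_field_linear[OF A] is_field_linear[OF B]
  have 0: "A n 0 = 0" "B n 0 = 0" for n using lin by (auto intro: clinear_op_0)
  have l: "clinear_op (\<lambda>u. c i *\<^sub>C A m (B n u))" "clinear_op (\<lambda>u. c i *\<^sub>C B n (A m u))" for i m n
    using lin[of m] lin[of n]
    by (simp_all add: linear_between_UNIV cscale_add_right cscale_cscale mult.commute)
  show "summable_fields (\<lambda>i p u. c i *\<^sub>C A (p + r - int i) (B (q + int i) u))"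
    unfolding summable_fields_def
  proof (intro conjI allI l)
    fix u
    obtain I where I: "\<And>n. n \<ge> I \<Longrightarrow> B n u = 0" using is_field_trunc[OF B] by metis
    let ?I = "nat (I - q)"
    have z: "A n (B (q + int i) u) = 0" if "i \<ge> ?I" for i n
      using I[of "q + int i"] that 0 by simp
    obtain M where M: "\<And>v n. n \<ge> M v \<Longrightarrow> A n v = 0" using is_field_trunc[OF A] by metis
    define K where "K = Max (insert 0 ((\<lambda>i. M (B (q + int i) u)) ` {..<?I}))"
    have K: "K \<ge> M (B (q + int i) u)" if "i < ?I" for i
      unfolding K_def using that by (intro Max_ge) auto
    have "A (n + r - int i) (B (q + int i) u) = 0" if "n \<ge> K + int ?I - r" for n i
    proof (cases "i < ?I")
      case True
      with K[OF True] that show ?thesis by (intro M) linarith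
    qed (simp add: z)
    then show "\<exists>N. \<forall>n\<ge>N. \<forall>i. c i *\<^sub>C A (n + r - int i) (B (q + int i) u) = 0"
      by (intro exI[of _ "K + int ?I - r"]) (simp add: cvec.scale_zero_right)
    show "finite {i. \<exists>n\<ge>n0. c i *\<^sub>C A (n + r - int i) (B (q + int i) u) \<noteq> 0}" for n0
    proof (rule finite_subset)
      show "{i. \<exists>n\<ge>n0. c i *\<^sub>C A (n + r - int i) (B (q + int i) u) \<noteq> 0} \<subseteq> {..<?I}"
      proof (rule subsetI, rule ccontr)
        fix i assume i: "i \<in> {i. \<exists>n\<ge>n0. c i *\<^sub>C A (n + r - int i) (B (q + int i) u) \<noteq> 0}" "i \<notin> {..<?I}"
        then have "i \<ge> ?I" by simp
        with i(1) z show False by (auto simp: cvec.scale_zero_right)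
      qed
    qed simp
  qed
  show "summable_fields (\<lambda>i p u. c i *\<^sub>C B (q + r - int i) (A (p + int i) u))"
    unfolding summable_fields_def
  proof (intro conjI allI l)
    fix u
    obtain N where N: "\<And>n. n \<ge> N \<Longrightarrow> A n u = 0" using is_field_trunc[OF A] by metis
    show "\<exists>N. \<forall>n\<ge>N. \<forall>i. c i *\<^sub>C B (q + r - int i) (A (n + int i) u) = 0"
      by (rule exI[of _ N]) (simp add: N 0 cvec.scale_zero_right)
    show "finite {i. \<exists>n\<ge>n0. c i *\<^sub>C B (q + r - int i) (A (n + int i) u) \<noteq> 0}" for n0
    proof (rule finite_subset)
      show "{i. \<exists>n\<ge>n0. c i *\<^sub>C B (q + r - int i) (A (n + int i) u) \<noteq> 0} \<subseteq> {..<nat (N - n0)}"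
      proof (rule subsetI, rule ccontr)
        fix i assume i: "i \<in> {i. \<exists>n\<ge>n0. c i *\<^sub>C B (q + r - int i) (A (n + int i) u) \<noteq> 0}"
          "i \<notin> {..<nat (N - n0)}"
        then have "n + int i \<ge> N" if "n \<ge> n0" for n using that by simp
        with i(1) N show False by (auto simp: 0 cvec.scale_zero_right)
      qed
    qed simp
  qed
qed

section \<open>Recursion for the two products of vertex operators\<close>

context heisenberg_field
begin

text \<open>
  For mutually commuting \<open>B\<close> and \<open>h\<close> the last sums in the next two lemmas are absent; they come from
  moving \<open>h j\<close> with \<open>j \<ge> 0\<close> to the right of \<open>B\<close>, respectively \<open>h j\<close> with \<open>j < 0\<close> to its left.
\<close>

lemma nop_before:
  assumes A: "is_field A" and B: "is_field B" and C: "\<And>t. is_field (C t)"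
    and comm: "\<And>j n u. h j (B n u) = B n (h j u) + (\<Sum>t<N. (of_int j gchoose t) *\<^sub>C C t (j + n - int t) u)"
  shows "nop k A n (B m u) = nop k (\<lambda>n u. A n (B m u)) n u +
    (\<Sum>t<N. (- of_nat t - 1 gchoose k) *\<^sub>C Sum_any (\<lambda>l. (- of_nat (t + k) - 1 gchoose l) *\<^sub>C
      ((- 1) ^ l *\<^sub>C A (n - int l - int t - int k - 1) (C t (m + int l) u))))"
proof -
  let ?c = "\<lambda>j::int. of_int (- j - 1) gchoose k :: complex"
  let ?d = "\<lambda>j. n - j - int k - 1"
  let ?X = "\<lambda>t j. if j < 0 then 0 else
    (?c j * (of_int j gchoose t)) *\<^sub>C A (?d j) (C t (j + m - int t) u)"
  have A_add: "A n (x + y) = A n x + A n y" and A_scale: "A n (c *\<^sub>C x) = c *\<^sub>C A n x"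
    and A_sum: "A n (sum f S) = (\<Sum>i\<in>S. A n (f i))" and A0: "A n 0 = 0" for n x y c and f :: "nat \<Rightarrow> 'w" and S
    using is_field_linear[OF A, of n] by (rule clinear_op_add clinear_op_scale clinear_op_sum clinear_op_0)+
  have finX: "finite {j. ?X t j \<noteq> 0}" for t
  proof -
    obtain M where "\<And>n. n \<ge> M \<Longrightarrow> C t n u = 0" using is_field_trunc[OF C] by metis
    note M = this
    have "{j. ?X t j \<noteq> 0} \<subseteq> {0..M - m + int t}"
    proof
      fix j assume "j \<in> {j. ?X t j \<noteq> 0}"
      then have "j \<ge> 0" and "C t (j + m - int t) u \<noteq> 0"
        by (auto simp: A0 cvec.scale_zero_right split: if_splits)
      moreover from this have "j + m - int t < M" using M not_le by metis
      ultimately show "j \<in> {0..M - m + int t}" by simp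
    qed
    then show ?thesis by (rule finite_subset) simp
  qed
  have "?c j *\<^sub>C ord j (A (?d j)) (B m u) = ?c j *\<^sub>C ord j (\<lambda>u. A (?d j) (B m u)) u + (\<Sum>t<N. ?X t j)" for j
    by (simp add: ord_def comm A_add A_sum A_scale cscale_add_right cvec.scale_sum_right cscale_cscale)
  then have "nop k A n (B m u) = nop k (\<lambda>n u. A n (B m u)) n u + (\<Sum>t<N. Sum_any (?X t))"
    unfolding nop_def
    using finite_nop[OF is_field_comp_right[OF A is_field_linear[OF B, of m]], of ?c n k u]
    by (simp only: Sum_any_add Sum_any_sum finX finite_lessThan)
  moreover have "Sum_any (?X t) = (- of_nat t - 1 gchoose k) *\<^sub>C Sum_any (\<lambda>l. (- of_nat (t + k) - 1 gchoose l) *\<^sub>C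
      ((- 1) ^ l *\<^sub>C A (n - int l - int t - int k - 1) (C t (m + int l) u)))" for t
  proof -
    have "Sum_any (?X t) = Sum_any (\<lambda>j::nat. ?X t (int j))"
      by (subst Sum_any_int_split[OF finX]) simp
    \<comment> \<open>The coefficient $binom(j,t)$ of the commutator formula vanishes for $0 \<le> j
      < t$.\<close>
    moreover have "\<dots> = Sum_any (\<lambda>l. ?X t (int (t + l)))"
      by (rule Sum_any_shift) (simp add: binomial_gbinomial[symmetric] binomial_eq_0 cvec.scale_zero_left)
    moreover have "?X t (int (t + l)) = (- of_nat t - 1 gchoose k) *\<^sub>C (- of_nat (t + k) - 1 gchoose l) *\<^sub>C
      ((- 1) ^ l *\<^sub>C A (n - int l - int t - int k - 1) (C t (m + int l) u))" for l
    proof -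
      have "?c (int (t + l)) * (of_int (int (t + l)) gchoose t) =
          (- of_nat t - 1 gchoose k) * ((- of_nat (t + k) - 1 gchoose l) * (- 1) ^ l)"
        using gchoose_expand_outer[of t l k] by (simp add: mult.commute)
      moreover have "?d (int (t + l)) = n - int l - int t - int k - 1" "int (t + l) + m - int t = m + int l"
        by simp_all
      ultimately show ?thesis by (simp only: cscale_cscale) simp
    qed
    ultimately show ?thesis by (simp only: Sum_any_scale)
  qed
  ultimately show ?thesis by simp
qed

lemma nop_after:
  assumes A: "is_field A" and B: "is_field B" and C: "\<And>t. is_field (C t)"
    and comm: "\<And>j n u. h j (B n u) = B n (h j u) + (\<Sum>t<N. (of_int j gchoose t) *\<^sub>C C t (j + n - int t) u)"
  shows "B m (nop k A n u) = nop k (\<lambda>n u. B m (A n u)) n u -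
    (\<Sum>t<N. ((- 1) ^ (t + k) * (- of_nat t - 1 gchoose k)) *\<^sub>C Sum_any (\<lambda>l. (- of_nat (t + k) - 1 gchoose l) *\<^sub>C
      ((- 1) ^ l *\<^sub>C C t (m - int l - int t - int k - 1) (A (n + int l) u))))"
proof -
  let ?c = "\<lambda>j::int. of_int (- j - 1) gchoose k :: complex"
  let ?d = "\<lambda>j. n - j - int k - 1"
  let ?X = "\<lambda>t j. if j < 0 then
    (?c j * (of_int j gchoose t)) *\<^sub>C C t (j + m - int t) (A (?d j) u) else 0"
  note B_lin = is_field_linear[OF B, of m]
  have C0: "C t n 0 = 0" for t n
    using is_field_linear[OF C] by (rule clinear_op_0)
  have finX: "finite {j. ?X t j \<noteq> 0}" for t
  proof -
    obtain M where M: "\<And>n. n \<ge> M \<Longrightarrow> A n u = 0" using is_field_trunc[OF A] by metis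
    have "{j. ?X t j \<noteq> 0} \<subseteq> {n - M - int k - 1..0}"
    proof
      fix j assume "j \<in> {j. ?X t j \<noteq> 0}"
      then have "j < 0" and "A (?d j) u \<noteq> 0"
        by (auto simp: C0 cvec.scale_zero_right split: if_splits)
      moreover from this have "?d j < M" using M not_le by metis
      ultimately show "j \<in> {n - M - int k - 1..0}" by simp
    qed
    then show ?thesis by (rule finite_subset) simp
  qed
  have finS: "finite {j. (\<Sum>t<N. ?X t j) \<noteq> 0}"
    by (rule Sum_any_sum) (simp_all add: finX)
  have "B m (?c j *\<^sub>C ord j (A (?d j)) u) = ?c j *\<^sub>C ord j (\<lambda>u. B m (A (?d j) u)) u - (\<Sum>t<N. ?X t j)" for j
    by (simp add: ord_def comm clinear_op_scale[OF B_lin] cscale_add_right cvec.scale_sum_right cscale_cscale)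
  then have "B m (nop k A n u) = nop k (\<lambda>n u. B m (A n u)) n u - (\<Sum>t<N. Sum_any (?X t))"
    unfolding nop_def clinear_op_Sum_any[OF B_lin finite_nop[OF A]]
    using finite_nop[OF is_field_comp_left[OF A B_lin], of ?c n k u]
    by (simp only: Sum_any_diff Sum_any_sum finX finS finite_lessThan)
  moreover have "Sum_any (?X t) = ((- 1) ^ (t + k) * (- of_nat t - 1 gchoose k)) *\<^sub>C Sum_any (\<lambda>l. (- of_nat (t + k) - 1 gchoose l) *\<^sub>C
      ((- 1) ^ l *\<^sub>C C t (m - int l - int t - int k - 1) (A (n + int l) u)))" for t
  proof -
    have "Sum_any (?X t) = Sum_any (\<lambda>j::nat. ?X t (- int j - 1))"
      by (subst Sum_any_int_split[OF finX]) simp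
    \<comment> \<open>Here the vanishing coefficient is that of $\<partial>^{(k)}h$: at the mode
      $-j-1$ it is $binom(j,k)$, zero for $0 \<le> j < k$.\<close>
    moreover have "\<dots> = Sum_any (\<lambda>l. ?X t (- int (k + l) - 1))"
      by (rule Sum_any_shift) (simp add: binomial_gbinomial[symmetric] binomial_eq_0 cvec.scale_zero_left)
    moreover have "?X t (- int (k + l) - 1) = ((- 1) ^ (t + k) * (- of_nat t - 1 gchoose k)) *\<^sub>C (- of_nat (t + k) - 1 gchoose l) *\<^sub>C
      ((- 1) ^ l *\<^sub>C C t (m - int l - int t - int k - 1) (A (n + int l) u))" for l
    proof -
      have "?c (- int (k + l) - 1) * (of_int (- int (k + l) - 1) gchoose t) =
          (- 1) ^ (t + k) * (- of_nat t - 1 gchoose k) * ((- of_nat (t + k) - 1 gchoose l) * (- 1) ^ l)"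
        using gchoose_expand_inner[of k l t] by (simp add: mult.commute)
      moreover have "- int (k + l) - 1 + m - int t = m - int l - int t - int k - 1" "?d (- int (k + l) - 1) = n + int l"
        by simp_all
      ultimately show ?thesis by (simp only: cscale_cscale) simp
    qed
    ultimately show ?thesis by (simp only: Sum_any_scale)
  qed
  ultimately show ?thesis by simp
qed

lemma uniform_bound:
  assumes "\<And>t. is_field (C t)"
  shows "\<exists>S. \<forall>t<(N::nat). \<forall>n\<ge>S. C t n u = 0"
proof (induction N)
  case (Suc N)
  then obtain S where S: "\<forall>t<N. \<forall>n\<ge>S. C t n u = 0" by blast
  obtain S' where "\<forall>n\<ge>S'. C N n u = 0" using is_field_trunc[OF assms] by blast
  with S show ?case by (intro exI[of _ "max S S'"]) (auto simp: less_Suc_eq)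
qed simp

text \<open>\<open>nop_before\<close> is applied in each term. Its corrections are coefficients of
  $(z_1-z_2)^{-t-k-1}$, and \<open>Sum_any_gchoose_conv\<close> multiplies them into the factor
  $(z_1-z_2)^r$, expanded in the same region; the result has exponent $r-t-k-1$.\<close>

lemma mode_product_nop_left:
  assumes A: "is_field A" and B: "is_field B" and C: "\<And>t. is_field (C t)"
    and comm: "\<And>j n u. h j (B n u) = B n (h j u) + (\<Sum>t<N. (of_int j gchoose t) *\<^sub>C C t (j + n - int t) u)"
  shows "mode_product (nop k A) B r q p u = nop k (mode_product A B r q) p u +
    (\<Sum>t<N. (- of_nat t - 1 gchoose k) *\<^sub>C mode_product A (C t) (r - int t - int k - 1) q p u)"
proof -
  let ?c = "\<lambda>i. (- 1) ^ i * (of_int r gchoose i) :: complex"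
  let ?F = "\<lambda>i p u. ?c i *\<^sub>C A (p + r - int i) (B (q + int i) u)"
  let ?H = "\<lambda>t s. (- 1) ^ s *\<^sub>C A (p + r - int s - int t - int k - 1) (C t (q + int s) u)"
  let ?G = "\<lambda>t i. (- of_nat t - 1 gchoose k) *\<^sub>C (of_int r gchoose i) *\<^sub>C
    Sum_any (\<lambda>l. (- of_nat (t + k) - 1 gchoose l) *\<^sub>C ?H t (i + l))"
  note F = summable_fields_mode_product(1)[OF A B, of ?c r q]
  have "\<exists>S. \<forall>t<N. \<forall>n\<ge>S. C t n u = 0" by (rule uniform_bound[OF C])
  then obtain S where "\<forall>t<N. \<forall>n\<ge>S. C t n u = 0" ..
  then have S: "\<And>t n. t < N \<Longrightarrow> n \<ge> S \<Longrightarrow> C t n u = 0" by simp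
  have H0: "?H t s = 0" if "t < N" "s \<ge> nat (S - q)" for t s
  proof -
    have "C t (q + int s) u = 0" using that by (intro S) auto
    then show ?thesis by (simp only: clinear_op_0[OF is_field_linear[OF A]] cvec.scale_zero_right)
  qed
  have finG: "finite {i. ?G t i \<noteq> 0}" if "t < N" for t
  proof (rule finite_nat_support[of "nat (S - q)"])
    fix i assume i: "nat (S - q) \<le> i"
    have H: "?H t (i + l) = 0" for l by (rule H0[OF that trans_le_add1[OF i]])
    show "?G t i = 0" unfolding H cvec.scale_zero_right by (simp add: cvec.scale_zero_right)
  qed
  have "finite {i. ?G t i \<noteq> 0}" if "t \<in> {..<N}" for t using that by (intro finG) simp
  note sumG = Sum_any_sum[of "{..<N}" ?G, OF finite_lessThan this]
  have "?c i *\<^sub>C nop k A (p + r - int i) (B (q + int i) u) = nop k (?F i) p u + (\<Sum>t<N. ?G t i)" for i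
  proof -
    have "?c i *\<^sub>C Sum_any (\<lambda>l. (- of_nat (t + k) - 1 gchoose l) *\<^sub>C
      ((- 1) ^ l *\<^sub>C A (p + r - int i - int l - int t - int k - 1) (C t (q + int i + int l) u))) =
      (of_int r gchoose i) *\<^sub>C Sum_any (\<lambda>l. (- of_nat (t + k) - 1 gchoose l) *\<^sub>C ?H t (i + l))" for t
      by (simp add: Sum_any_scale cscale_cscale power_add algebra_simps)
    then have "?c i *\<^sub>C (- of_nat t - 1 gchoose k) *\<^sub>C Sum_any (\<lambda>l. (- of_nat (t + k) - 1 gchoose l) *\<^sub>C
      ((- 1) ^ l *\<^sub>C A (p + r - int i - int l - int t - int k - 1) (C t (q + int i + int l) u))) = ?G t i" for t
      by (simp only: cvec.scale_left_commute[of "?c i"])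
    moreover have "nop k (?F i) p u = ?c i *\<^sub>C nop k (\<lambda>n u. A n (B (q + int i) u)) (p + r - int i) u"
      using nop_scale_shift[of k "?c i" "\<lambda>n u. A n (B (q + int i) u)" "r - int i" p u] by (simp only: add_diff_eq)
    ultimately show ?thesis
      by (simp only: nop_before[OF A B C comm] cscale_add_right cvec.scale_sum_right)
  qed
  then have "mode_product (nop k A) B r q p u = Sum_any (\<lambda>i. nop k (?F i) p u) + (\<Sum>t<N. Sum_any (?G t))"
    by (simp only: mode_product_def Sum_any_add[OF finite_nop_Sum_any[OF F] sumG(1)] sumG(2))
  also have "Sum_any (\<lambda>i. nop k (?F i) p u) = nop k (mode_product A B r q) p u"
    by (simp only: nop_Sum_any[OF F, symmetric] mode_product_def[abs_def])
  also have "(\<Sum>t<N. Sum_any (?G t)) =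
      (\<Sum>t<N. (- of_nat t - 1 gchoose k) *\<^sub>C mode_product A (C t) (r - int t - int k - 1) q p u)"
  proof (rule sum.cong[OF refl])
    fix t assume "t \<in> {..<N}"
    then have t: "t < N" by simp
    have "Sum_any (?G t) = (- of_nat t - 1 gchoose k) *\<^sub>C
        Sum_any (\<lambda>s. (of_int r + (- of_nat (t + k) - 1) gchoose s) *\<^sub>C ?H t s)"
      unfolding Sum_any_scale[symmetric]
      by (subst Sum_any_gchoose_conv[of "nat (S - q)" "?H t"]) (rule H0[OF t], assumption, rule refl)
    also have "of_int r + (- of_nat (t + k) - 1) = (of_int (r - int t - int k - 1) :: complex)" by simp
    finally show "Sum_any (?G t) = (- of_nat t - 1 gchoose k) *\<^sub>C mode_product A (C t) (r - int t - int k - 1) q p u"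
      by (simp add: mode_product_def cscale_cscale mult.commute algebra_simps)
  qed
  finally show ?thesis .
qed

text \<open>The mirror image with \<open>nop_after\<close>, in the region $|z_2|>|z_1|$. The sign
  $(-1)^{t+k}$ comes from writing the pole in terms of $z_2-z_1$.\<close>

lemma mode_product_nop_right:
  assumes A: "is_field A" and B: "is_field B" and C: "\<And>t. is_field (C t)"
    and comm: "\<And>j n u. h j (B n u) = B n (h j u) + (\<Sum>t<N. (of_int j gchoose t) *\<^sub>C C t (j + n - int t) u)"
  shows "mode_product B (nop k A) r p q u = nop k (\<lambda>p. mode_product B A r p q) p u -
    (\<Sum>t<N. ((- 1) ^ (t + k) * (- of_nat t - 1 gchoose k)) *\<^sub>C mode_product (C t) A (r - int t - int k - 1) p q u)"
proof -
  let ?c = "\<lambda>i. (- 1) ^ i * (of_int r gchoose i) :: complex"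
  let ?F = "\<lambda>i p u. ?c i *\<^sub>C B (q + r - int i) (A (p + int i) u)"
  let ?b = "\<lambda>t. (- 1) ^ (t + k) * (- of_nat t - 1 gchoose k) :: complex"
  let ?H = "\<lambda>t s. (- 1) ^ s *\<^sub>C C t (q + r - int s - int t - int k - 1) (A (p + int s) u)"
  let ?G = "\<lambda>t i. ?b t *\<^sub>C (of_int r gchoose i) *\<^sub>C
    Sum_any (\<lambda>l. (- of_nat (t + k) - 1 gchoose l) *\<^sub>C ?H t (i + l))"
  note F = summable_fields_mode_product(2)[OF A B, of ?c q r]
  obtain S where S: "\<And>n. n \<ge> S \<Longrightarrow> A n u = 0" using is_field_trunc[OF A] by metis
  have H0: "?H t s = 0" if "s \<ge> nat (S - p)" for t s
  proof -
    have "A (p + int s) u = 0" using that by (intro S) auto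
    then show ?thesis by (simp only: clinear_op_0[OF is_field_linear[OF C]] cvec.scale_zero_right)
  qed
  have finG: "finite {i. ?G t i \<noteq> 0}" for t
  proof (rule finite_nat_support[of "nat (S - p)"])
    fix i assume i: "nat (S - p) \<le> i"
    have H: "?H t (i + l) = 0" for l by (rule H0[OF trans_le_add1[OF i]])
    show "?G t i = 0" unfolding H cvec.scale_zero_right by (simp add: cvec.scale_zero_right)
  qed
  note sumG = Sum_any_sum[of "{..<N}" ?G, OF finite_lessThan finG]
  have "?c i *\<^sub>C B (q + r - int i) (nop k A (p + int i) u) = nop k (?F i) p u - (\<Sum>t<N. ?G t i)" for i
  proof -
    have "?c i *\<^sub>C Sum_any (\<lambda>l. (- of_nat (t + k) - 1 gchoose l) *\<^sub>C
      ((- 1) ^ l *\<^sub>C C t (q + r - int i - int l - int t - int k - 1) (A (p + int i + int l) u))) =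
      (of_int r gchoose i) *\<^sub>C Sum_any (\<lambda>l. (- of_nat (t + k) - 1 gchoose l) *\<^sub>C ?H t (i + l))" for t
      by (simp add: Sum_any_scale cscale_cscale power_add algebra_simps)
    then have "?c i *\<^sub>C ?b t *\<^sub>C Sum_any (\<lambda>l. (- of_nat (t + k) - 1 gchoose l) *\<^sub>C
      ((- 1) ^ l *\<^sub>C C t (q + r - int i - int l - int t - int k - 1) (A (p + int i + int l) u))) = ?G t i" for t
      by (simp only: cvec.scale_left_commute[of "?c i"])
    moreover have "nop k (?F i) p u = ?c i *\<^sub>C nop k (\<lambda>n u. B (q + r - int i) (A n u)) (p + int i) u"
      using nop_scale_shift[of k "?c i" "\<lambda>n u. B (q + r - int i) (A n u)" "int i" p u] by simp
    ultimately show ?thesis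
      by (simp only: nop_after[OF A B C comm] cvec.scale_right_diff_distrib cvec.scale_sum_right)
  qed
  then have "mode_product B (nop k A) r p q u = Sum_any (\<lambda>i. nop k (?F i) p u) - (\<Sum>t<N. Sum_any (?G t))"
    by (simp only: mode_product_def Sum_any_diff[OF finite_nop_Sum_any[OF F] sumG(1)] sumG(2))
  also have "Sum_any (\<lambda>i. nop k (?F i) p u) = nop k (\<lambda>p. mode_product B A r p q) p u"
    by (simp only: nop_Sum_any[OF F, symmetric] mode_product_def[abs_def])
  also have "(\<Sum>t<N. Sum_any (?G t)) =
      (\<Sum>t<N. ?b t *\<^sub>C mode_product (C t) A (r - int t - int k - 1) p q u)"
  proof (rule sum.cong[OF refl])
    fix t
    have "Sum_any (?G t) = ?b t *\<^sub>C
        Sum_any (\<lambda>s. (of_int r + (- of_nat (t + k) - 1) gchoose s) *\<^sub>C ?H t s)"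
      unfolding Sum_any_scale[symmetric]
      by (subst Sum_any_gchoose_conv[of "nat (S - p)" "?H t"]) (rule H0, assumption, rule refl)
    also have "of_int r + (- of_nat (t + k) - 1) = (of_int (r - int t - int k - 1) :: complex)" by simp
    finally show "Sum_any (?G t) = ?b t *\<^sub>C mode_product (C t) A (r - int t - int k - 1) p q u"
      by (simp add: mode_product_def cscale_cscale mult.commute algebra_simps)
  qed
  finally show ?thesis .
qed

end


section \<open>Recursion for the iterate\<close>

context heisenberg_field
begin

text \<open>
  The modes of $Y(Y(a,z_0)b,z_2)$ as they enter the Jacobi identity.  Multiplying $a$ by $x_k$ turns
  them into their normally ordered product with $\partial^{(k)}h$, up to terms in which $b$ is
  replaced by $h(t)b$; \<open>mode_product\<close> satisfies the same recursion.
\<close>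

definition iterate :: "fock \<Rightarrow> fock \<Rightarrow> int \<Rightarrow> int \<Rightarrow> int \<Rightarrow> 'w \<Rightarrow> 'w"
  where "iterate a b r q p u =
    Sum_any (\<lambda>i::nat. (of_int p gchoose i) *\<^sub>C heis_Y h (heis_Y (heis 0) a (r + int i) b) (p + q - int i) u)"

text \<open>The annihilation half of $\<partial>^{(k)}h$ acts on \<open>b\<close> and yields the
  corrections; the creation half multiplies by the variables $x_{k+l}$. The explicit bounds
  \<open>N\<close> and \<open>S\<close> turn both halves into finite sums that can be exchanged
  freely.\<close>

lemma nop_vacuum_split:
  assumes A: "is_field A" and N: "\<And>t. t \<ge> N \<Longrightarrow> heis 0 (int t) b = 0"
    and S: "\<And>s. s \<ge> S \<Longrightarrow> A (n + int s) b = 0"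
  shows "V.nop k A n b = (\<Sum>t<N. (- of_nat t - 1 gchoose k) *\<^sub>C A (n - int t - int k - 1) (heis 0 (int t) b)) +
    (\<Sum>l<S. (of_nat (k + l) gchoose k) *\<^sub>C (mon {#k + l#} * A (n + int l) b))"
proof -
  let ?X = "\<lambda>j::int. (of_int (- j - 1) gchoose k) *\<^sub>C V.ord j (A (n - j - int k - 1)) b"
  have A0: "A m 0 = 0" for m using is_field_linear[OF A] by (rule clinear_op_0)
  have "V.nop k A n b = Sum_any (\<lambda>t. ?X (int t)) + Sum_any (\<lambda>m. ?X (- int m - 1))"
    unfolding V.nop_def by (rule Sum_any_int_split) (rule V.finite_nop[OF A])
  moreover have "Sum_any (\<lambda>t. ?X (int t)) = (\<Sum>t<N. ?X (int t))"
    by (rule Sum_any_lessThan) (simp add: V.ord_def N A0 cvec.scale_zero_right)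
  moreover have "?X (int t) = (- of_nat t - 1 gchoose k) *\<^sub>C A (n - int t - int k - 1) (heis 0 (int t) b)" for t
    by (simp add: V.ord_def)
  moreover have "Sum_any (\<lambda>m. ?X (- int m - 1)) = Sum_any (\<lambda>l. ?X (- int (k + l) - 1))"
    by (rule Sum_any_shift) (simp add: binomial_gbinomial[symmetric] binomial_eq_0 cvec.scale_zero_left)
  moreover have e: "?X (- int (k + l) - 1) = (of_nat (k + l) gchoose k) *\<^sub>C (mon {#k + l#} * A (n + int l) b)" for l
  proof -
    have 1: "n - (- int (k + l) - 1) - int k - 1 = n + int l"
      "of_int (- (- int (k + l) - 1) - 1) = (of_nat (k + l) :: complex)"
      "nat (- (- int (k + l) - 1) - 1) = k + l" by simp_all
    have "- int (k + l) - 1 < 0" by simp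
    then show ?thesis unfolding V.ord_def heis_def[of _ "- int (k + l) - 1"] 1 by (simp only: if_True)
  qed
  moreover have "Sum_any (\<lambda>l. (of_nat (k + l) gchoose k) *\<^sub>C (mon {#k + l#} * A (n + int l) b)) =
      (\<Sum>l<S. (of_nat (k + l) gchoose k) *\<^sub>C (mon {#k + l#} * A (n + int l) b))"
    by (rule Sum_any_lessThan) (simp add: S cvec.scale_zero_right)
  ultimately show ?thesis by (simp only:)
qed

text \<open>The annihilation half of $Y(x_k a,z_0)b$ gives the sum over \<open>t\<close> directly.
  In the creation half each $x_{k+l}$ becomes a factor $\<partial>^{(k+l)}h(z_2)$ on the module, and
  the sum over \<open>l\<close> of $binom(k+l,k) z_0^l \<partial>^{(k+l)}h(z_2)$ is the Taylor
  expansion of $\<partial>^{(k)}h(z_2+z_0)$. With $z_1=z_2+z_0$ this is the normally ordered product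
  in the index \<open>p\<close>.\<close>

lemma iterate_var_times:
  assumes N: "\<And>t. t \<ge> N \<Longrightarrow> heis 0 (int t) b = 0"
  shows "iterate (mon {#k#} * a) b r q p u = nop k (iterate a b r q) p u +
    (\<Sum>t<N. (- of_nat t - 1 gchoose k) *\<^sub>C iterate a (heis 0 (int t) b) (r - int t - int k - 1) q p u)"
proof -
  let ?A = "heis_Y (heis 0) a"
  have A: "is_field ?A" by (rule V.is_field_heis_Y)
  have "\<exists>M. \<forall>n\<ge>M. ?A n b = 0" by (rule is_field_trunc[OF A])
  then obtain M1 where M1: "\<forall>n\<ge>M1. ?A n b = 0" ..
  have "\<exists>M. \<forall>t<N. \<forall>n\<ge>M. ?A n (heis 0 (int t) b) = 0"
    by (rule V.uniform_bound) (rule is_field_comp_right[OF A V.h_linear])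
  then obtain M2 where M2: "\<forall>t<N. \<forall>n\<ge>M2. ?A n (heis 0 (int t) b) = 0" ..
  have "\<exists>M. \<forall>n\<ge>M. heis_Y (heis 0) (mon {#k#} * a) n b = 0"
    by (rule is_field_trunc[OF V.is_field_heis_Y])
  then obtain M3 where M3: "\<forall>n\<ge>M3. heis_Y (heis 0) (mon {#k#} * a) n b = 0" ..
  define M where "M = max M1 (max M2 M3)"
  \<comment> \<open>\<open>S\<close> exceeds the three truncation bounds even after the mode has
    been lowered by $t+k+1$ with $t<N$, so one range serves all sums.\<close>
  define S where "S = nat (M - r + int N + int k + 1)"
  have S: "?A (r + int s) b = 0" if "s \<ge> S" for s
    by (rule M1[rule_format]) (use that in \<open>simp add: S_def M_def\<close>)
  have St: "?A (r - int t - int k - 1 + int s) (heis 0 (int t) b) = 0" if "s \<ge> S" "t < N" for s t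
    by (rule M2[rule_format]) (use that in \<open>simp_all add: S_def M_def\<close>)
  have S3: "heis_Y (heis 0) (mon {#k#} * a) (r + int s) b = 0" if "s \<ge> S" for s
    by (rule M3[rule_format]) (use that in \<open>simp add: S_def M_def\<close>)
  let ?Y = "heis_Y h"
  let ?c = "\<lambda>s. ?A (r + int s) b"
  have c0: "?c s = 0" if "s \<ge> S" for s using S that by simp
  have Yadd: "?Y (x + y) n u = ?Y x n u + ?Y y n u" and Ysum: "?Y (sum f T) n u = (\<Sum>i\<in>T. ?Y (f i) n u)"
    and Y0: "?Y 0 n u = 0"
    for x y n and f :: "nat \<Rightarrow> fock" and T
    by (simp_all add: heis_Y_add heis_Y_0 clinear_op_sum[OF linear_heis_Y])
  have "heis_Y (heis 0) (mon {#k#} * a) (r + int i) b =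
      (\<Sum>t<N. (- of_nat t - 1 gchoose k) *\<^sub>C ?A (r - int t - int k - 1 + int i) (heis 0 (int t) b)) +
      (\<Sum>l<S. (of_nat (k + l) gchoose k) *\<^sub>C (mon {#k + l#} * ?c (i + l)))" for i
  proof -
    have S': "?A (r + int i + int s) b = 0" if "s \<ge> S" for s
      using S[of "i + s"] that by (simp add: add.assoc)
    have "r + int i + int l = r + int (i + l)" "r + int i - int t - int k - 1 = r - int t - int k - 1 + int i" for l t
      by simp_all
    then show ?thesis
      by (simp only: V.heis_Y_var_times nop_vacuum_split[where N = N and S = S, OF A N S'])
  qed
  then have Ystep: "?Y (heis_Y (heis 0) (mon {#k#} * a) (r + int i) b) n u =
      (\<Sum>t<N. (- of_nat t - 1 gchoose k) *\<^sub>C ?Y (?A (r - int t - int k - 1 + int i) (heis 0 (int t) b)) n u) +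
      (\<Sum>l<S. (of_nat (k + l) gchoose k) *\<^sub>C nop (k + l) (?Y (?c (i + l))) n u)" for i n
    by (simp only: Yadd Ysum heis_Y_scale heis_Y_var_times)
  have "iterate (mon {#k#} * a) b r q p u =
      (\<Sum>i<S. (of_int p gchoose i) *\<^sub>C ?Y (heis_Y (heis 0) (mon {#k#} * a) (r + int i) b) (p + q - int i) u)"
    unfolding iterate_def by (rule Sum_any_lessThan) (simp only: S3 Y0 cvec.scale_zero_right)
  also have "\<dots> = (\<Sum>i<S. \<Sum>t<N. (- of_nat t - 1 gchoose k) *\<^sub>C (of_int p gchoose i) *\<^sub>C
        ?Y (?A (r - int t - int k - 1 + int i) (heis 0 (int t) b)) (p + q - int i) u) +
      (\<Sum>i<S. \<Sum>l<S. ((of_int p gchoose i) * (of_nat (k + l) gchoose k)) *\<^sub>C nop (k + l) (?Y (?c (i + l))) (p + q - int i) u)"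
    unfolding Ystep sum.distrib[symmetric]
    by (simp only: cscale_add_right cvec.scale_sum_right cscale_cscale mult.commute)
  also have "(\<Sum>i<S. \<Sum>t<N. (- of_nat t - 1 gchoose k) *\<^sub>C (of_int p gchoose i) *\<^sub>C
        ?Y (?A (r - int t - int k - 1 + int i) (heis 0 (int t) b)) (p + q - int i) u) =
      (\<Sum>t<N. (- of_nat t - 1 gchoose k) *\<^sub>C iterate a (heis 0 (int t) b) (r - int t - int k - 1) q p u)"
  proof (subst sum.swap, rule sum.cong[OF refl])
    fix t assume "t \<in> {..<N}"
    then have "iterate a (heis 0 (int t) b) (r - int t - int k - 1) q p u =
        (\<Sum>i<S. (of_int p gchoose i) *\<^sub>C ?Y (?A (r - int t - int k - 1 + int i) (heis 0 (int t) b)) (p + q - int i) u)"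
      unfolding iterate_def by (intro Sum_any_lessThan) (simp only: St lessThan_iff Y0 cvec.scale_zero_right)
    then show "(\<Sum>i<S. (- of_nat t - 1 gchoose k) *\<^sub>C (of_int p gchoose i) *\<^sub>C
        ?Y (?A (r - int t - int k - 1 + int i) (heis 0 (int t) b)) (p + q - int i) u) =
      (- of_nat t - 1 gchoose k) *\<^sub>C iterate a (heis 0 (int t) b) (r - int t - int k - 1) q p u"
      by (simp only: cvec.scale_sum_right)
  qed
  also have "(\<Sum>i<S. \<Sum>l<S. ((of_int p gchoose i) * (of_nat (k + l) gchoose k)) *\<^sub>C nop (k + l) (?Y (?c (i + l))) (p + q - int i) u) =
      nop k (iterate a b r q) p u"
  proof -
    let ?z = "\<lambda>j::int. of_int (- j - 1) :: complex"
    let ?H = "\<lambda>j s. ord j (?Y (?c s) (p + q - int s - j - int k - 1)) u"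
    let ?X = "\<lambda>i l j. ((of_int p gchoose i) * (?z j gchoose k) * (?z j - of_nat k gchoose l)) *\<^sub>C ?H j (i + l)"
    have H0: "?H j s = 0" if "s \<ge> S" for j s
      by (rule ord_zero) (simp only: c0[OF that] heis_Y_0)
    have step: "((of_int p gchoose i) * (of_nat (k + l) gchoose k)) *\<^sub>C nop (k + l) (?Y (?c (i + l))) (p + q - int i) u =
        Sum_any (?X i l)" for i l
    proof -
      \<comment> \<open>Trinomial revision: with $z=-j-1$, $binom(k+l,k) binom(z,k+l) = binom(z,k)
        binom(z-k,l)$. The first factor is the coefficient in \<open>nop k\<close>; the second
        remains for the sum over \<open>l\<close>.\<close>
      have "(of_int p gchoose i) * (of_nat (k + l) gchoose k) * (?z j gchoose (k + l)) =
          (of_int p gchoose i) * (?z j gchoose k) * (?z j - of_nat k gchoose l)" for j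
        using gbinomial_trinomial_revision[of k "k + l" "?z j"] by (simp add: mult_ac)
      moreover have "p + q - int i - j - int (k + l) - 1 = p + q - int (i + l) - j - int k - 1" for j by simp
      ultimately show ?thesis by (simp only: nop_def Sum_any_scale cscale_cscale)
    qed
    have fin: "finite {j. ?X i l j \<noteq> 0}" for i l
      using finite_nop[OF is_field_heis_Y, of _ _ "p + q - int (i + l)"] by simp
    have "(\<Sum>i<S. \<Sum>l<S. Sum_any (?X i l)) = Sum_any (\<lambda>j. \<Sum>i<S. \<Sum>l<S. ?X i l j)"
      by (simp only: Sum_any_sum fin finite_lessThan)
    moreover have "(\<Sum>i<S. \<Sum>l<S. ?X i l j) = (?z j gchoose k) *\<^sub>C
        ord j (iterate a b r q (p - j - int k - 1)) u" for j
    proof -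
      have "(\<Sum>i<S. \<Sum>l<S. ?X i l j) = (?z j gchoose k) *\<^sub>C
          Sum_any (\<lambda>i. (of_int p gchoose i) *\<^sub>C Sum_any (\<lambda>l. (?z j - of_nat k gchoose l) *\<^sub>C ?H j (i + l)))"
      proof -
        have "Sum_any (\<lambda>l. (?z j - of_nat k gchoose l) *\<^sub>C ?H j (i + l)) =
            (\<Sum>l<S. (?z j - of_nat k gchoose l) *\<^sub>C ?H j (i + l))" for i
          by (rule Sum_any_lessThan) (simp only: H0[OF trans_le_add2] cvec.scale_zero_right)
        moreover have "Sum_any (\<lambda>i. (of_int p gchoose i) *\<^sub>C (\<Sum>l<S. (?z j - of_nat k gchoose l) *\<^sub>C ?H j (i + l))) =
            (\<Sum>i<S. (of_int p gchoose i) *\<^sub>C (\<Sum>l<S. (?z j - of_nat k gchoose l) *\<^sub>C ?H j (i + l)))"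
          by (rule Sum_any_lessThan) (simp only: H0[OF trans_le_add1] cvec.scale_zero_right sum.neutral_const)
        ultimately show ?thesis
          by (simp only: cvec.scale_sum_right cscale_cscale mult_ac)
      qed
      \<comment> \<open>Vandermonde merges $binom(p,i)$ and $binom(-j-1-k,l)$ into
        $binom(p-j-k-1,s)$, which is exactly the shift of \<open>p\<close> that \<open>nop k\<close>
        prescribes.\<close>
      also have "\<dots> = (?z j gchoose k) *\<^sub>C Sum_any (\<lambda>s. (of_int p + (?z j - of_nat k) gchoose s) *\<^sub>C ?H j s)"
        by (subst Sum_any_gchoose_conv[of S "?H j"]) (rule H0, assumption, rule refl)
      also have "Sum_any (\<lambda>s. (of_int p + (?z j - of_nat k) gchoose s) *\<^sub>C ?H j s) =
          (\<Sum>s<S. (of_int p + (?z j - of_nat k) gchoose s) *\<^sub>C ?H j s)"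
        by (rule Sum_any_lessThan) (simp only: H0 cvec.scale_zero_right)
      also have "\<dots> = ord j (iterate a b r q (p - j - int k - 1)) u"
      proof -
        have "of_int p + (?z j - of_nat k) = (of_int (p - j - int k - 1) :: complex)" by simp
        moreover have "p - j - int k - 1 + q - int s = p + q - int s - j - int k - 1" for s by simp
        moreover have "iterate a b r q p' = (\<lambda>u. \<Sum>s<S. (of_int p' gchoose s) *\<^sub>C ?Y (?c s) (p' + q - int s) u)" for p'
          unfolding iterate_def
          by (intro ext Sum_any_lessThan) (simp only: c0 heis_Y_0 cvec.scale_zero_right)
        ultimately show ?thesis by (simp only: ord_sum ord_scale)
      qed
      finally show ?thesis .
    qed
    then have "Sum_any (\<lambda>j. \<Sum>i<S. \<Sum>l<S. ?X i l j) = nop k (iterate a b r q) p u"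
      by (simp only: nop_def)
    ultimately show ?thesis by (simp only: step)
  qed
  finally show ?thesis by (simp only: add.commute)
qed

end

text \<open>The two terms on the right are the coefficients of $z_1^{-p-1}$, up to a power of $z_2$,
  in $(z_1-z_2)^r$ expanded for $|z_1|>|z_2|$ and for $|z_2|>|z_1|$. The expansions agree for $r
  \<ge> 0$; for $r<0$ they differ by a divided derivative of the delta function, with coefficient
  $binom(p,-r-1)$. The cases are the signs of \<open>r\<close> and \<open>p\<close>.\<close>

lemma gchoose_vacuum_identity:
  "(if r < 0 then of_int p gchoose nat (- r - 1) else 0 :: complex) =
    (if p + r + 1 \<ge> 0 then (- 1) ^ nat (p + r + 1) * (of_int r gchoose nat (p + r + 1)) else 0) -
    (if p < 0 then (- 1) powi r * ((- 1) ^ nat (- p - 1) * (of_int r gchoose nat (- p - 1))) else 0)"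
proof -
  consider m n where "r = int m" "p = int n" | m n where "r = int m" "p = - int n - 1"
    | m n where "r = - int m - 1" "p = int n" | m n where "r = - int m - 1" "p = - int n - 1"
  proof -
    have "(\<exists>m. x = int m) \<or> (\<exists>m. x = - int m - 1)" for x
    proof (cases "x \<ge> 0")
      case True
      then have "x = int (nat x)" by simp
      then show ?thesis by blast
    next
      case False
      then have "x = - int (nat (- x - 1)) - 1" by simp
      then show ?thesis by blast
    qed
    from this[of r] this[of p] that show thesis by blast
  qed
  then show ?thesis
  proof cases
    case 1
    then have "nat (p + r + 1) = Suc (n + m)" "\<not> r < 0" "\<not> p < 0" by auto
    moreover have "(of_int r gchoose Suc (n + m) :: complex) = 0"
      by (simp only: 1 of_int_of_nat_eq binomial_gbinomial[symmetric]) (simp add: binomial_eq_0)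
    ultimately show ?thesis by simp
  next
    case 2
    then have e: "nat (- p - 1) = n" "\<not> r < 0" "p < 0" by auto
    have r: "(of_int r gchoose k :: complex) = of_nat (m choose k)" for k
      by (simp only: 2 of_int_of_nat_eq binomial_gbinomial)
    have s: "(- 1 :: complex) powi r = (- 1) ^ m" by (simp only: 2 power_int_of_nat)
    show ?thesis
    proof (cases "n \<le> m")
      case True
      then have "nat (p + r + 1) = m - n" "p + r + 1 \<ge> 0" using 2 by auto
      moreover have "m choose (m - n) = m choose n" using True by (simp add: binomial_symmetric[symmetric])
      moreover have "(- 1 :: complex) ^ (m - n) = (- 1) ^ m * (- 1) ^ n"
        using True by (auto simp: minus_one_power_iff)
      ultimately show ?thesis using e unfolding r s by simp
    next
      case False
      then have "\<not> p + r + 1 \<ge> 0" using 2 by auto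
      with False e show ?thesis unfolding r by (simp add: binomial_eq_0)
    qed
  next
    case 3
    then have e: "nat (- r - 1) = m" "r < 0" "\<not> p < 0" by auto
    have p: "(of_int p gchoose m :: complex) = of_nat (n choose m)"
      by (simp only: 3 of_int_of_nat_eq binomial_gbinomial)
    show ?thesis
    proof (cases "m \<le> n")
      case True
      then have 1: "nat (p + r + 1) = n - m" "p + r + 1 \<ge> 0" using 3 by auto
      have "of_int r = (- of_nat m - 1 :: complex)" using 3 by simp
      then have "(of_int r gchoose (n - m)) = (- 1) ^ (n - m) * (of_nat (m + (n - m) choose (n - m)) :: complex)"
        by (simp only: gchoose_neg_of_nat)
      moreover have "m + (n - m) choose (n - m) = n choose m" using True by (simp add: binomial_symmetric[symmetric])
      ultimately have "(- 1) ^ (n - m) * (of_int r gchoose (n - m)) = (of_nat (n choose m) :: complex)"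
        by (auto simp: minus_one_power_iff)
      then show ?thesis using 1 e by (simp add: p)
    next
      case False
      then have "\<not> p + r + 1 \<ge> 0" using 3 by auto
      with False e show ?thesis by (simp add: p binomial_eq_0)
    qed
  next
    case 4
    then have e: "nat (- r - 1) = m" "nat (- p - 1) = n" "r < 0" "p < 0" "\<not> p + r + 1 \<ge> 0" by auto
    have "of_int r = (- of_nat m - 1 :: complex)" "of_int p = (- of_nat n - 1 :: complex)" using 4 by simp_all
    then have "(of_int r gchoose n) = (- 1) ^ n * (of_nat (m + n choose n) :: complex)"
      "(of_int p gchoose m) = (- 1) ^ m * (of_nat (n + m choose m) :: complex)"
      by (simp_all only: gchoose_neg_of_nat)
    moreover have "n + m choose m = m + n choose n"
      using binomial_symmetric[of n "m + n"] by (simp add: add.commute)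
    moreover have "(- 1 :: complex) powi r = - ((- 1) ^ m)"
    proof -
      have r: "r = - int (Suc m)" using 4 by simp
      have "(- 1 :: complex) powi r = inverse ((- 1) ^ Suc m)"
        unfolding r power_int_minus power_int_of_nat ..
      then show ?thesis by (simp add: minus_one_power_iff)
    qed
    ultimately show ?thesis using e by (simp add: minus_one_power_iff)
  qed
qed

lemma Sum_any_index:
  fixes f :: "nat \<Rightarrow> 'a::comm_monoid_add"
  assumes "\<And>i. int i \<noteq> z \<Longrightarrow> f i = 0"
  shows "Sum_any f = (if z \<ge> 0 then f (nat z) else 0)"
proof -
  have "f i = 0" if "i \<noteq> nat z" for i using assms[of i] that by auto
  then have "Sum_any f = sum f {nat z}" by (intro Sum_any.expand_superset) auto
  then show ?thesis using assms[of "nat z"] by auto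
qed


context heisenberg_field
begin

lemma iterate_vacuum:
  "iterate 1 b r q p u = mode_product (heis_Y h 1) (heis_Y h b) r q p u -
    ((- 1) powi r) *\<^sub>C mode_product (heis_Y h b) (heis_Y h 1) r p q u"
proof -
  let ?B = "heis_Y h b (p + q + r + 1) u"
  have B0: "heis_Y h b n 0 = 0" for n using is_field_linear[OF is_field_heis_Y] by (rule clinear_op_0)
  have "iterate 1 b r q p u = (if r < 0 then of_int p gchoose nat (- r - 1) else 0) *\<^sub>C ?B"
    unfolding iterate_def
    by (subst Sum_any_index[of "- r - 1"])
      (auto simp: heis_Y_vacuum heis_Y_0 cvec.scale_zero_right algebra_simps)
  moreover have "mode_product (heis_Y h 1) (heis_Y h b) r q p u =
      (if p + r + 1 \<ge> 0 then (- 1) ^ nat (p + r + 1) * (of_int r gchoose nat (p + r + 1)) else 0) *\<^sub>C ?B"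
    unfolding mode_product_def
    by (subst Sum_any_index[of "p + r + 1"])
      (auto simp: heis_Y_vacuum cvec.scale_zero_right algebra_simps)
  moreover have "mode_product (heis_Y h b) (heis_Y h 1) r p q u =
      (if p < 0 then ((- 1) ^ nat (- p - 1) * (of_int r gchoose nat (- p - 1))) else 0) *\<^sub>C ?B"
    unfolding mode_product_def
    by (subst Sum_any_index[of "- p - 1"])
      (auto simp: heis_Y_vacuum B0 cvec.scale_zero_right algebra_simps)
  ultimately show ?thesis
    unfolding gchoose_vacuum_identity[of r p]
    by (simp add: cscale_cscale cvec.scale_left_diff_distrib)
qed

text \<open>For a monomial \<open>a\<close>, the main terms of the three recursions match by the
  induction hypothesis under \<open>nop k\<close>, the corrections by the hypothesis for $h(t)b$ and
  $r-t-k-1$; this is why \<open>b\<close> and all indices are generalized. Linearity in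
  \<open>a\<close> gives the rest.\<close>

theorem iterate_eq_commutator:
  "iterate a b r q p u = mode_product (heis_Y h a) (heis_Y h b) r q p u -
    ((- 1) powi r) *\<^sub>C mode_product (heis_Y h b) (heis_Y h a) r p q u"
proof -
  have mon: "iterate (mon A) b r q p u = mode_product (heis_Y h (mon A)) (heis_Y h b) r q p u -
    ((- 1) powi r) *\<^sub>C mode_product (heis_Y h b) (heis_Y h (mon A)) r p q u" for A b r q p u
  proof (induction A arbitrary: b r q p u)
    case empty
    then show ?case using iterate_vacuum by simp
  next
    case (add k A)
    let ?Y = "heis_Y h"
    let ?A = "?Y (mon A)" and ?C = "\<lambda>t. ?Y (heis 0 (int t) b)"
    let ?z = "\<lambda>t. - of_nat t - 1 gchoose k :: complex"
    have "\<exists>N. \<forall>n\<ge>N. heis 0 n b = 0" by (rule heis_trunc)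
    then obtain N0 where N0: "\<forall>n\<ge>N0. heis 0 n b = 0" ..
    define N where "N = nat N0"
    have N: "heis 0 (int t) b = 0" if "t \<ge> N" for t
      using N0 that by (simp add: N_def)
    have comm: "h j (?Y b n u) = ?Y b n (h j u) + (\<Sum>t<N. (of_int j gchoose t) *\<^sub>C ?C t (j + n - int t) u)" for j n u
      unfolding h_heis_Y
      by (subst Sum_any_lessThan[of N]) (simp_all only: N heis_Y_0 cvec.scale_zero_right)
    note fields = is_field_heis_Y[of "mon A"] is_field_heis_Y[of b] is_field_heis_Y
    have IH: "iterate (mon A) b r q = (\<lambda>p u. mode_product ?A (?Y b) r q p u +
        (- ((- 1) powi r)) *\<^sub>C mode_product (?Y b) ?A r p q u)" for b r q
      by (intro ext) (simp add: add.IH cvec.scale_minus_left)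
    have f1: "is_field (mode_product ?A (?Y b) r q)" and f2: "is_field (\<lambda>p. mode_product (?Y b) ?A r p q)"
      unfolding mode_product_def[abs_def]
      by (rule is_field_Sum_any, rule summable_fields_mode_product, rule fields, rule fields)+
    have "iterate (mon (add_mset k A)) b r q p u = nop k (iterate (mon A) b r q) p u +
        (\<Sum>t<N. ?z t *\<^sub>C iterate (mon A) (heis 0 (int t) b) (r - int t - int k - 1) q p u)"
      unfolding mon_add_mset[of k A] by (rule iterate_var_times) (rule N)
    also have "nop k (iterate (mon A) b r q) p u = nop k (mode_product ?A (?Y b) r q) p u -
        ((- 1) powi r) *\<^sub>C nop k (\<lambda>p. mode_product (?Y b) ?A r p q) p u"
    proof -
      have "nop k (\<lambda>p u. (- ((- 1) powi r)) *\<^sub>C mode_product (?Y b) ?A r p q u) p u =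
          (- ((- 1) powi r)) *\<^sub>C nop k (\<lambda>p. mode_product (?Y b) ?A r p q) p u"
        by (rule nop_scale)
      then show ?thesis
        unfolding IH nop_add[OF f1 is_field_scale[OF f2]] by (simp add: cvec.scale_minus_left)
    qed
    also have "(\<Sum>t<N. ?z t *\<^sub>C iterate (mon A) (heis 0 (int t) b) (r - int t - int k - 1) q p u) =
        (\<Sum>t<N. ?z t *\<^sub>C mode_product ?A (?C t) (r - int t - int k - 1) q p u) +
        ((- 1) powi r) *\<^sub>C (\<Sum>t<N. ((- 1) ^ (t + k) * ?z t) *\<^sub>C mode_product (?C t) ?A (r - int t - int k - 1) p q u)"
    proof -
      \<comment> \<open>Lowering \<open>r\<close> by $t+k+1$ changes the prefactor $-(-1)^r$ by the
        very sign $(-1)^{t+k}$, up to the minus in \<open>mode_product_nop_right\<close>, that the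
        other region of expansion brings in.\<close>
      have sign: "- ((- 1) powi (r - int t - int k - 1)) = (- 1 :: complex) powi r * (- 1) ^ (t + k)" for t
        by (simp add: power_int_diff power_int_add power_add field_simps flip: power_mult_distrib)
      have "?z t *\<^sub>C iterate (mon A) (heis 0 (int t) b) (r - int t - int k - 1) q p u =
        ?z t *\<^sub>C mode_product ?A (?C t) (r - int t - int k - 1) q p u +
        ((- 1) powi r) *\<^sub>C ((- 1) ^ (t + k) * ?z t) *\<^sub>C mode_product (?C t) ?A (r - int t - int k - 1) p q u" for t
        unfolding IH sign cscale_add_right cscale_cscale by (simp only: mult_ac)
      then show ?thesis by (simp only: sum.distrib cvec.scale_sum_right)
    qed
    finally show ?case
      unfolding heis_Y_mon_add_mset mode_product_nop_left[OF fields comm] mode_product_nop_right[OF fields comm]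
      by (simp add: cvec.scale_right_diff_distrib algebra_simps)
  qed
  show ?thesis
  proof (rule linear_eqI[where u = a and f = "\<lambda>a. iterate a b r q p u"], goal_cases)
    case 1
    have "clinear_op (\<lambda>a. (of_int p gchoose i) *\<^sub>C heis_Y h (heis_Y (heis 0) a (r + int i) b) (p + q - int i) u)" for i :: nat
      by (simp add: linear_between_UNIV heis_Y_add heis_Y_scale cscale_add_right cscale_cscale mult.commute)
    moreover have "finite {i. (of_int p gchoose i) *\<^sub>C heis_Y h (heis_Y (heis 0) a (r + int i) b) (p + q - int i) u \<noteq> 0}" for a
    proof -
      have "\<exists>M. \<forall>n\<ge>M. heis_Y (heis 0) a n b = 0" by (rule is_field_trunc[OF V.is_field_heis_Y])
      then obtain M where "\<forall>n\<ge>M. heis_Y (heis 0) a n b = 0" ..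
      then show ?thesis
        by (intro finite_nat_support[of "nat (M - r)"]) (simp add: heis_Y_0 cvec.scale_zero_right)
    qed
    ultimately show ?case unfolding iterate_def by (rule clinear_op_Sum_any_fun)
  next
    case 2
    let ?c = "\<lambda>i. (- 1) ^ i * (of_int r gchoose i) :: complex"
    note F = summable_fieldsD(2)[OF summable_fields_mode_product(1)[OF is_field_heis_Y is_field_heis_Y, of ?c]]
    have B: "heis_Y h b n (x + y) = heis_Y h b n x + heis_Y h b n y" "heis_Y h b n (c *\<^sub>C x) = c *\<^sub>C heis_Y h b n x" for n x y c
      using is_field_linear[OF is_field_heis_Y] by (auto simp: linear_between_UNIV)
    have "clinear_op (\<lambda>a. mode_product (heis_Y h a) (heis_Y h b) r q p u)"
      unfolding mode_product_def
      by (rule clinear_op_Sum_any_fun)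
        (simp add: linear_between_UNIV heis_Y_add heis_Y_scale cscale_add_right cscale_cscale mult.commute, rule F)
    moreover have "clinear_op (\<lambda>a. mode_product (heis_Y h b) (heis_Y h a) r p q u)"
      unfolding mode_product_def
      by (rule clinear_op_Sum_any_fun)
        (simp add: linear_between_UNIV heis_Y_add heis_Y_scale B cscale_add_right cscale_cscale mult.commute, rule F)
    ultimately show ?case
      by (simp add: linear_between_UNIV cscale_cscale cvec.scale_right_diff_distrib cscale_add_right mult.commute)
  qed (rule mon)
qed

end


text \<open>Only the operations of \<open>U\<close> and \<open>M\<close> enter, so this serves the
  subalgebra $M(1)^+$ and submodules as well.\<close>

lemma (in heisenberg_field) jacobi_identity_heis_Y:
  assumes "voa_Y U = heis_Y (heis 0)" "act M = heis_Y h"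
  shows "jacobi_identity U M a b u"
  unfolding jacobi_identity_def assms
proof (intro allI)
  fix p q r :: int
  let ?c = "\<lambda>i. (- 1) ^ i * (of_int r gchoose i) :: complex" and ?s = "(- 1) powi r :: complex"
  let ?A = "heis_Y h a" and ?B = "heis_Y h b"
  have 1: "finite {i. ?c i *\<^sub>C ?A (p + r - int i) (?B (q + int i) u) \<noteq> 0}"
    by (rule summable_fieldsD(2)[OF summable_fields_mode_product(1)]) (rule is_field_heis_Y)+
  have "finite {i. ?c i *\<^sub>C ?B (q + r - int i) (?A (p + int i) u) \<noteq> 0}"
    by (rule summable_fieldsD(2)[OF summable_fields_mode_product(1)]) (rule is_field_heis_Y)+
  then have 2: "finite {i. ?s *\<^sub>C ?c i *\<^sub>C ?B (q + r - int i) (?A (p + int i) u) \<noteq> 0}"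
    by (rule rev_finite_subset) (auto simp: cvec.scale_zero_right)
  show "Sum_any (\<lambda>i::nat. (of_int p gchoose i) *\<^sub>C heis_Y h (heis_Y (heis 0) a (r + int i) b) (p + q - int i) u) =
    Sum_any (\<lambda>i::nat. ?c i *\<^sub>C (?A (p + r - int i) (?B (q + int i) u) - ?s *\<^sub>C ?B (q + r - int i) (?A (p + int i) u)))"
    unfolding iterate_def[symmetric] iterate_eq_commutator mode_product_def Sum_any_scale
      Sum_any_diff[OF 1 2, symmetric] cvec.scale_right_diff_distrib
    by (simp only: cvec.scale_left_commute)
qed

section \<open>Naturality and the parity automorphism\<close>

text \<open>The scalar covers two uses: $c=1$ for maps of Heisenberg modules and $c=-1$ for parity
  maps, where the power of \<open>c\<close> is the eigenvalue of \<open>theta\<close> on the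
  monomial.\<close>

lemma normal_product_natural:
  assumes h: "heisenberg_field h" and h': "heisenberg_field h'"
    and f: "clinear_op f" and fh: "\<And>n u. f (h n u) = c *\<^sub>C h' n (f u)"
  shows "f (normal_product h ks n u) = c ^ length ks *\<^sub>C normal_product h' ks n (f u)"
proof (induction ks arbitrary: n u)
  case Nil
  then show ?case by (simp add: clinear_op_0[OF f])
next
  case (Cons k ks)
  interpret h: heisenberg_field h by fact
  interpret h': heisenberg_field h' by fact
  let ?A = "normal_product h ks" and ?A' = "normal_product h' ks"
  have "f (h.ord j (?A m) u) = (c * c ^ length ks) *\<^sub>C h'.ord j (?A' m) (f u)" for j m
    by (simp add: h.ord_def h'.ord_def fh Cons.IH h'.h_simps cscale_cscale mult.commute
        clinear_op_scale[OF is_field_linear[OF h'.is_field_normal_product]])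
  then show ?case
    unfolding h.normal_product_Cons h'.normal_product_Cons h.nop_def h'.nop_def
    by (simp only: clinear_op_Sum_any[OF f h.finite_nop[OF h.is_field_normal_product]]
        clinear_op_scale[OF f] Sum_any_scale cscale_cscale length_Cons power_Suc mult.commute)
qed

lemma heis_Y_natural:
  assumes "heisenberg_field h" "heisenberg_field h'"
    and f: "clinear_op f" and fh: "\<And>n u. f (h n u) = h' n (f u)"
  shows "f (heis_Y h a n u) = heis_Y h' a n (f u)"
  using normal_product_natural[OF assms(1-3), of 1] fh
  by (simp add: heis_Y_def clinear_op_sum[OF f] clinear_op_scale[OF f] cscale_one)

lemma lookup_theta: "Poly_Mapping.lookup (theta u) A = (- 1) ^ size A * Poly_Mapping.lookup u A"
  by (simp add: theta_def lookup_mapp when_def in_keys_iff)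

lemma linear_theta: "clinear_op theta"
  unfolding linear_between_UNIV
  by (auto intro!: poly_mapping_eqI simp: lookup_theta lookup_add cscale_complex_def algebra_simps)

lemma theta_mon: "theta (mon A) = (- 1) ^ size A *\<^sub>C mon A"
  by (rule poly_mapping_eqI) (auto simp: lookup_theta lookup_single when_def cscale_complex_def)

text \<open>Each $h$ in a normally ordered product contributes one sign, and \<open>theta\<close>
  collects them. When \<open>theta a = a\<close>, such an \<open>f\<close> intertwines the two
  actions of \<open>a\<close>.\<close>

lemma heis_Y_theta:
  assumes h: "heisenberg_field h" "heisenberg_field h'"
    and f: "clinear_op f" and fh: "\<And>n u. f (h n u) = - h' n (f u)"
  shows "f (heis_Y h a n u) = heis_Y h' (theta a) n (f u)"
proof (rule linear_eqI[where u = a and f = "\<lambda>a. f (heis_Y h a n u)" and g = "\<lambda>a. heis_Y h' (theta a) n (f u)"], goal_cases)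
  case 1
  show ?case
    by (simp add: linear_between_UNIV heis_Y_add heis_Y_scale clinear_op_add[OF f] clinear_op_scale[OF f])
next
  case 2
  show ?case
    by (simp add: linear_between_UNIV heis_Y_add heis_Y_scale clinear_op_add[OF linear_theta]
        clinear_op_scale[OF linear_theta])
next
  case (3 A)
  have "f (h n u) = (- 1) *\<^sub>C h' n (f u)" for n u
    by (simp add: fh cvec.scale_minus_left cscale_one)
  then have *: "f (normal_product h ks n u) = (- 1) ^ length ks *\<^sub>C normal_product h' ks n (f u)" for ks n u
    by (rule normal_product_natural[OF h f])
  have "length (sorted_list_of_multiset A) = size A"
    by (metis mset_sorted_list_of_multiset size_mset)
  then show ?case by (simp only: heis_Y_mon theta_mon heis_Y_scale *)
qed

lemma theta_heis: "theta (heis 0 n u) = - heis 0 n (theta u)"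
proof -
  have var: "theta (mon {#k#} * u) = - (mon {#k#} * theta u)" for k
  proof (rule linear_eqI[where u = u], goal_cases)
    case 1
    show ?case using linear_theta by (simp add: linear_between_UNIV distrib_left cscale_times)
  next
    case 2
    show ?case using linear_theta
      by (simp add: linear_between_UNIV distrib_left cscale_times cvec.scale_minus_right)
  next
    case (3 A)
    show ?case
      by (simp only: mon_add_mset[of k A, symmetric] theta_mon cscale_times)
        (simp add: cvec.scale_minus_left)
  qed
  have "theta (fock_deriv k u) = - fock_deriv k (theta u)" for k
    by (rule poly_mapping_eqI) (simp add: lookup_fock_deriv lookup_theta)
  with var show ?thesis
    using linear_theta clinear_op_0[OF linear_theta]
    by (simp add: heis_def linear_between_UNIV cvec.scale_zero_left cvec.scale_minus_right)
qed

section \<open>Self-extensions of the Fock modules\<close>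

text \<open>
  \<open>h(0)\<close> acts on two copies of \<open>M(1,\<nu>)\<close> by the Jordan block with eigenvalue \<open>\<nu>\<close> and off-diagonal
  entry \<open>\<epsilon>\<close>; for \<open>\<epsilon> = 0\<close> this is the direct sum.
\<close>

definition heis_ext :: "complex \<Rightarrow> complex \<Rightarrow> int \<Rightarrow> fock \<times> fock \<Rightarrow> fock \<times> fock"
  where "heis_ext \<nu> \<epsilon> n u =
    (heis \<nu> n (fst u) + (if n = 0 then \<epsilon> *\<^sub>C snd u else 0), heis \<nu> n (snd u))"

lemma heis_linear: "clinear_op (heis \<nu> n)"
  using heisenberg_rep_heis by (simp add: heisenberg_rep_def)

text \<open>Since $h(0)$ is central in the Heisenberg algebra, any operator commuting with all
  $h(n)$ may be added to it, here \<epsilon> times the nilpotent map $(x,y) \<mapsto>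
  (y,0)$.\<close>

lemma heisenberg_field_heis_ext: "heisenberg_field (heis_ext \<nu> \<epsilon>)"
proof
  interpret F: heisenberg_field "heis \<nu>" by (rule heisenberg_field_heis)
  show "heisenberg_rep (heis_ext \<nu> \<epsilon>)"
    unfolding heisenberg_rep_def
  proof (intro conjI allI)
    show "clinear_op (heis_ext \<nu> \<epsilon> n)" for n
      by (auto simp: linear_between_UNIV heis_ext_def F.h_simps cscale_prod_def cscale_add_right
          cscale_cscale mult.commute)
    show "heis_ext \<nu> \<epsilon> m (heis_ext \<nu> \<epsilon> n w) - heis_ext \<nu> \<epsilon> n (heis_ext \<nu> \<epsilon> m w) =
        (if m = - n then of_int m *\<^sub>C w else 0)" for m n w
      using F.h_comm[of m n "fst w"] F.h_comm[of m n "snd w"]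
      by (auto simp: heis_ext_def F.h_simps cscale_prod_def prod_eq_iff cvec.scale_zero_left)
  qed
  show "\<exists>N. \<forall>n\<ge>N. heis_ext \<nu> \<epsilon> n w = 0" for w
  proof -
    obtain N1 where N1: "\<forall>n\<ge>N1. heis \<nu> n (fst w) = 0" using F.trunc[of "fst w"] ..
    obtain N2 where N2: "\<forall>n\<ge>N2. heis \<nu> n (snd w) = 0" using F.trunc[of "snd w"] ..
    \<comment> \<open>The lower bound 1 keeps clear of the off-diagonal part at $n=0$.\<close>
    from N1 N2 show ?thesis
      by (intro exI[of _ "max 1 (max N1 N2)"]) (auto simp: heis_ext_def prod_eq_iff)
  qed
qed

lemma heis_Y_heis_ext_zero: "heis_Y (heis_ext \<nu> 0) a n (x, y) = (heis_Y (heis \<nu>) a n x, heis_Y (heis \<nu>) a n y)"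
  using heis_Y_natural[OF heisenberg_field_heis_ext[of \<nu> 0] heisenberg_field_heis[of \<nu>], of fst a n "(x, y)"]
    heis_Y_natural[OF heisenberg_field_heis_ext[of \<nu> 0] heisenberg_field_heis[of \<nu>], of snd a n "(x, y)"]
  by (simp add: linear_between_UNIV heis_ext_def cscale_prod_def prod_eq_iff cvec.scale_zero_left)

text \<open>The inclusion and the projection commute with every $h(n)$, hence with all vertex
  operators by \<open>heis_Y_natural\<close>. Closure is asked only of \<theta>-fixed
  \<open>a\<close>, because parity subspaces are stable under $M(1)^+$ but not under $M(1)$.\<close>

lemma extension_heis_ext:
  assumes S: "cvec.subspace S1" "cvec.subspace S2"
    and closed: "\<And>a n u. theta a = a \<Longrightarrow> u \<in> S1 \<times> S2 \<Longrightarrow> heis_Y (heis_ext \<nu> \<epsilon>) a n u \<in> S1 \<times> S2"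
  shows "(\<lparr>space = S1 \<times> S2, act = heis_Y (heis_ext \<nu> \<epsilon>)\<rparr>, \<lambda>x. (x, 0), snd) \<in>
    extensions Heis_plus \<lparr>space = S2, act = heis_Y (heis \<nu>)\<rparr> \<lparr>space = S1, act = heis_Y (heis \<nu>)\<rparr>"
proof -
  interpret E: heisenberg_field "heis_ext \<nu> \<epsilon>" by (rule heisenberg_field_heis_ext)
  let ?M = "\<lparr>space = S1 \<times> S2, act = heis_Y (heis_ext \<nu> \<epsilon>)\<rparr>"
  have V: "voa_space Heis_plus = {a. theta a = a}" "voa_Y Heis_plus = heis_Y (heis 0)" "vacuum Heis_plus = 1"
    by (simp_all add: Heis_plus_def Heis_def)
  have Y: "heis_Y (heis_ext \<nu> \<epsilon>) a n (u + v) = heis_Y (heis_ext \<nu> \<epsilon>) a n u + heis_Y (heis_ext \<nu> \<epsilon>) a n v"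
    "heis_Y (heis_ext \<nu> \<epsilon>) a n (c *\<^sub>C u) = c *\<^sub>C heis_Y (heis_ext \<nu> \<epsilon>) a n u" for a n u v c
    by (rule clinear_op_add[OF is_field_linear[OF E.is_field_heis_Y]],
        rule clinear_op_scale[OF is_field_linear[OF E.is_field_heis_Y]])
  have "cvec.subspace (S1 \<times> S2)"
    using S by (auto simp: cvec.subspace_def cscale_prod_def zero_prod_def)
  then have "weak_module Heis_plus ?M"
    unfolding weak_module_def V wmodule.simps mem_Collect_eq
  proof (intro conjI ballI allI)
    show "linear_between (S1 \<times> S2) (S1 \<times> S2) (heis_Y (heis_ext \<nu> \<epsilon>) a n)" if "a \<in> {a. theta a = a}" for a n
      unfolding linear_between_def using closed that by (simp add: Y Pi_iff)
    show "linear_between {a. theta a = a} (S1 \<times> S2) (\<lambda>a. heis_Y (heis_ext \<nu> \<epsilon>) a n u)" if "u \<in> S1 \<times> S2" for n u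
      unfolding linear_between_def using closed that by (simp add: heis_Y_add heis_Y_scale Pi_iff)
    show "\<exists>N. \<forall>n\<ge>N. heis_Y (heis_ext \<nu> \<epsilon>) a n u = 0" for a u
      by (rule is_field_trunc[OF E.is_field_heis_Y])
    show "heis_Y (heis_ext \<nu> \<epsilon>) 1 n u = (if n = - 1 then u else 0)" for n u
      by (rule heis_Y_vacuum)
    show "jacobi_identity Heis_plus ?M a b u" for a b u
      by (rule E.jacobi_identity_heis_Y) (simp_all add: V)
  qed
  moreover have "0 \<in> S1" "0 \<in> S2" using S by (auto simp: cvec.subspace_0)
  moreover have "(heis_Y (heis \<nu>) a n x, 0) = heis_Y (heis_ext \<nu> \<epsilon>) a n (x, 0)" for a n x
    by (rule heis_Y_natural[where f = "\<lambda>x. (x, 0)", OF heisenberg_field_heis heisenberg_field_heis_ext])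
      (auto simp: linear_between_UNIV heis_ext_def cscale_prod_def cvec.scale_zero_right
        clinear_op_0[OF heis_linear])
  moreover have "snd (heis_Y (heis_ext \<nu> \<epsilon>) a n u) = heis_Y (heis \<nu>) a n (snd u)" for a n u
    by (rule heis_Y_natural[where f = snd, OF heisenberg_field_heis_ext heisenberg_field_heis])
      (auto simp: linear_between_UNIV heis_ext_def cscale_prod_def)
  ultimately show ?thesis
    by (auto simp: extensions_def module_hom_on_def linear_between_def inj_on_def cscale_prod_def
        cvec.scale_zero_right image_iff)
qed

text \<open>The whole family in \<epsilon> is used: $\<epsilon>=0$ is literally the split extension,
  so the same lemma shows that the unit class is represented, and $\<epsilon>=1$ is the candidate
  for a nontrivial class.\<close>

lemma Ext1_heis_ext_nontrivial:
  assumes S: "cvec.subspace S1" "cvec.subspace S2"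
    and closed: "\<And>\<epsilon> a n u. theta a = a \<Longrightarrow> u \<in> S1 \<times> S2 \<Longrightarrow> heis_Y (heis_ext \<nu> \<epsilon>) a n u \<in> S1 \<times> S2"
    and no_section: "\<And>s. module_hom_on Heis_plus \<lparr>space = S2, act = heis_Y (heis \<nu>)\<rparr>
      \<lparr>space = S1 \<times> S2, act = heis_Y (heis_ext \<nu> 1)\<rparr> s \<Longrightarrow> \<forall>y\<in>S2. snd (s y) = y \<Longrightarrow> False"
  shows "\<exists>\<xi>\<in>carrier (Ext1 Heis_plus \<lparr>space = S2, act = heis_Y (heis \<nu>)\<rparr> \<lparr>space = S1, act = heis_Y (heis \<nu>)\<rparr>).
    \<xi> \<noteq> \<one>\<^bsub>Ext1 Heis_plus \<lparr>space = S2, act = heis_Y (heis \<nu>)\<rparr> \<lparr>space = S1, act = heis_Y (heis \<nu>)\<rparr>\<^esub>"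
proof -
  let ?M1 = "\<lparr>space = S1, act = heis_Y (heis \<nu>)\<rparr>" and ?M2 = "\<lparr>space = S2, act = heis_Y (heis \<nu>)\<rparr>"
  let ?E = "\<lambda>\<epsilon>. (\<lparr>space = S1 \<times> S2, act = heis_Y (heis_ext \<nu> \<epsilon>)\<rparr>, \<lambda>x. (x, 0), snd)"
  have E: "?E \<epsilon> \<in> extensions Heis_plus ?M2 ?M1" for \<epsilon>
    by (rule extension_heis_ext[OF S]) (rule closed)
  have "split_extension ?M2 ?M1 = ?E 0"
    by (simp add: split_extension_def direct_sum_def fun_eq_iff heis_Y_heis_ext_zero)
  then have "split_extension ?M2 ?M1 \<in> extensions Heis_plus ?M2 ?M1" using E by simp
  note splits_iff = Ext1_class_eq_one_iff_splits[OF E[of 1] this]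
  have "extension_equiv Heis_plus ?M2 ?M1 `` {?E 1} \<noteq> \<one>\<^bsub>Ext1 Heis_plus ?M2 ?M1\<^esub>"
  proof
    assume "extension_equiv Heis_plus ?M2 ?M1 `` {?E 1} = \<one>\<^bsub>Ext1 Heis_plus ?M2 ?M1\<^esub>"
    then obtain s where "module_hom_on Heis_plus ?M2 \<lparr>space = S1 \<times> S2, act = heis_Y (heis_ext \<nu> 1)\<rparr> s"
      and "\<forall>y\<in>space ?M2. snd (s y) = y"
      unfolding splits_iff by blast
    then show False by (intro no_section[of s]) simp_all
  qed
  moreover have "extension_equiv Heis_plus ?M2 ?M1 `` {?E 1} \<in> carrier (Ext1 Heis_plus ?M2 ?M1)"
    unfolding Ext1_def partial_object.simps by (rule quotientI) (rule E)
  ultimately show ?thesis by (rule bexI)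
qed


section \<open>Nonsplitness\<close>

lemma lookup_var_times:
  "Poly_Mapping.lookup (mon {#k#} * u) A = (if k \<in># A then Poly_Mapping.lookup u (A - {#k#}) else 0)"
proof (rule linear_eqI[where u = u and f = "\<lambda>u. Poly_Mapping.lookup (mon {#k#} * u) A"
      and g = "\<lambda>u. if k \<in># A then Poly_Mapping.lookup u (A - {#k#}) else 0"], goal_cases)
  case (3 B)
  show ?case by (cases "k \<in># A") (auto simp flip: mon_add_mset simp: lookup_single when_def)
qed (auto simp: linear_between_UNIV distrib_left lookup_add cscale_times cscale_complex_def)

lemma lookup_heis_neg:
  "n < 0 \<Longrightarrow> nat (- n - 1) \<notin># A \<Longrightarrow> Poly_Mapping.lookup (heis \<nu> n u) A = 0"
  by (simp add: heis_def lookup_var_times)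

text \<open>Twice the conformal vector.\<close>

abbreviation omega :: fock where "omega \<equiv> mon {#0, 0#}"

lemma theta_omega: "theta omega = omega"
  by (simp add: theta_mon cscale_one)

section \<open>Single coefficients of the modes of \<open>omega\<close>\<close>

lemma (in heisenberg_field) heis_Y_omega:
  "heis_Y h omega n u = Sum_any (\<lambda>j. ord j (h (n - j - 1)) u)"
  and finite_heis_Y_omega: "finite {j. ord j (h (n - j - 1)) u \<noteq> 0}"
proof -
  have h: "is_field h" using h_linear trunc by (simp add: is_field_def)
  have "normal_product h [0] m v = h m v" for m v
    using heis_Y_generator[OF rep, of 0 m v] heis_Y_mon[of h "{#0#}" m v]
    by (simp add: heis_def)
  then have "normal_product h [0] = h" by (intro ext)
  then have "heis_Y h omega n u = nop 0 h n u"
    by (simp add: heis_Y_mon normal_product_Cons del: normal_product.simps)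
  then show "heis_Y h omega n u = Sum_any (\<lambda>j. ord j (h (n - j - 1)) u)"
    by (simp add: nop_def cscale_one)
  show "finite {j. ord j (h (n - j - 1)) u \<noteq> 0}"
    using finite_nop[OF h, of "\<lambda>_. 1" n 0 u] by (simp add: cscale_one)
qed

text \<open>Nonsplitness is read off from one coefficient of one vector, and only finitely many
  explicit \<open>j\<close> contribute to it: a leftmost creation operator can only produce
  monomials containing its own variable.\<close>

lemma (in heisenberg_field) functional_heis_Y_omega:
  assumes c: "clinear_op c" and S: "finite S" "\<And>j. j \<notin> S \<Longrightarrow> c (ord j (h (n - j - 1)) u) = 0"
  shows "c (heis_Y h omega n u) = (\<Sum>j\<in>S. c (ord j (h (n - j - 1)) u))"
  unfolding heis_Y_omega clinear_op_Sum_any[OF c finite_heis_Y_omega]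
  by (rule Sum_any.expand_superset) (use S in auto)

lemma linear_lookup_fst: "clinear_op (\<lambda>u :: fock \<times> fock. Poly_Mapping.lookup (fst u) A)"
  by (simp add: linear_between_UNIV lookup_add cscale_prod_def)

text \<open>At the constant monomial only $h(0)^2$ survives in $2L(0)$; the square of the Jordan
  block has diagonal $\<nu>^2$ and off-diagonal entry $2\<nu>\<epsilon>$.\<close>

lemma omega_1_const:
  "Poly_Mapping.lookup (fst (heis_Y (heis_ext \<nu> \<epsilon>) omega 1 (x, y))) {#} =
    \<nu> ^ 2 * Poly_Mapping.lookup x {#} + 2 * \<nu> * \<epsilon> * Poly_Mapping.lookup y {#}"
proof -
  interpret E: heisenberg_field "heis_ext \<nu> \<epsilon>" by (rule heisenberg_field_heis_ext)
  have "Poly_Mapping.lookup (fst (heis_Y (heis_ext \<nu> \<epsilon>) omega 1 (x, y))) {#} =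
      (\<Sum>j\<in>{0}. Poly_Mapping.lookup (fst (E.ord j (heis_ext \<nu> \<epsilon> (1 - j - 1)) (x, y))) {#})"
    by (rule E.functional_heis_Y_omega[OF linear_lookup_fst])
      (auto simp: E.ord_def heis_ext_def lookup_heis_neg)
  then show ?thesis
    by (simp add: E.ord_def heis_ext_def heis_def lookup_add cscale_complex_def)
      (simp add: power2_eq_square algebra_simps)
qed

text \<open>At the monomial $x_0$ only $h(-1)h(0)$ survives in $2L(-1)$. It occurs for $j=-1$ and
  $j=0$, whence the factor 2, and for $\<nu>=0$ the operator $h(0)$ sends $(x,y)$ to
  $(y,0)$.\<close>

lemma omega_0_var:
  "Poly_Mapping.lookup (fst (heis_Y (heis_ext 0 1) omega 0 (x, y))) {#0#} = 2 * Poly_Mapping.lookup y {#}"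
proof -
  interpret E: heisenberg_field "heis_ext 0 1" by (rule heisenberg_field_heis_ext)
  have "Poly_Mapping.lookup (fst (heis_Y (heis_ext 0 1) omega 0 (x, y))) {#0#} =
      (\<Sum>j\<in>{- 1, 0}. Poly_Mapping.lookup (fst (E.ord j (heis_ext 0 1 (0 - j - 1)) (x, y))) {#0#})"
    by (rule E.functional_heis_Y_omega[OF linear_lookup_fst])
      (auto simp: E.ord_def heis_ext_def lookup_heis_neg)
  then show ?thesis
    by (simp add: E.ord_def heis_ext_def heis_def lookup_var_times cscale_one cvec.scale_zero_left)
qed

text \<open>The adjoint situation: at the constant monomial only $h(0)h(1)$ survives in $2L(1)$, for
  $j=0$ and $j=1$.\<close>

lemma omega_2_const:
  "Poly_Mapping.lookup (fst (heis_Y (heis_ext 0 1) omega 2 (x, y))) {#} = 2 * Poly_Mapping.lookup y {#0#}"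
proof -
  interpret E: heisenberg_field "heis_ext 0 1" by (rule heisenberg_field_heis_ext)
  have "Poly_Mapping.lookup (fst (heis_Y (heis_ext 0 1) omega 2 (x, y))) {#} =
      (\<Sum>j\<in>{0, 1}. Poly_Mapping.lookup (fst (E.ord j (heis_ext 0 1 (2 - j - 1)) (x, y))) {#})"
    by (rule E.functional_heis_Y_omega[OF linear_lookup_fst])
      (auto simp: E.ord_def heis_ext_def lookup_heis_neg)
  then show ?thesis
    by (simp add: E.ord_def heis_ext_def heis_def lookup_fock_deriv cscale_one cvec.scale_zero_left
        clinear_op_0[OF linear_fock_deriv])
qed

lemma omega_1_vacuum: "heis_Y (heis \<nu>) omega 1 1 = \<nu> ^ 2 *\<^sub>C 1"
proof -
  interpret F: heisenberg_field "heis \<nu>" by (rule heisenberg_field_heis)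
  have "clinear_op (\<lambda>u :: fock. u)" by (simp add: linear_between_UNIV)
  from F.functional_heis_Y_omega[OF this, of "{0}" 1 1]
  show ?thesis
    by (simp add: F.ord_def heis_vacuum F.h_simps cscale_cscale power2_eq_square)
qed

lemma omega_0_vacuum: "heis_Y (heis 0) omega 0 1 = 0"
proof -
  have "V.ord j (heis 0 (0 - j - 1)) 1 = 0" for j
    by (auto simp: V.ord_def heis_vacuum V.h_simps cvec.scale_zero_left)
  then show ?thesis by (simp add: V.heis_Y_omega)
qed

lemma omega_2_var: "heis_Y (heis 0) omega 2 (mon {#0#}) = 0"
proof -
  have x: "heis 0 n (mon {#0#}) = 0" if "n \<ge> 0" "n \<noteq> 1" for n
    using that by (auto simp: heis_def fock_deriv_mon cvec.scale_zero_left cvec.scale_zero_right)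
  have "V.ord j (heis 0 (2 - j - 1)) (mon {#0#}) = 0" for j
    by (cases "j = 1") (auto simp: V.ord_def x V.h_simps heis_def[of 0 0] cvec.scale_zero_left)
  then show ?thesis by (simp add: V.heis_Y_omega)
qed

lemma module_hom_onD:
  assumes "module_hom_on U M N f" "u \<in> space M"
  shows "f u \<in> space N" "f (c *\<^sub>C u) = c *\<^sub>C f u" "a \<in> voa_space U \<Longrightarrow> f (act M a n u) = act N a n (f u)"
  using assms by (auto simp: module_hom_on_def linear_between_def)

lemma omega_mem: "omega \<in> voa_space Heis_plus"
  by (simp add: Heis_plus_def Heis_def theta_omega)

section \<open>Self-extensions for nonzero \<nu>\<close>

lemma Ext1_Fock_Fock:
  assumes "\<nu> \<noteq> 0"
  shows "\<exists>\<xi>\<in>carrier (Ext1 Heis_plus (Fock \<nu>) (Fock \<nu>)). \<xi> \<noteq> \<one>\<^bsub>Ext1 Heis_plus (Fock \<nu>) (Fock \<nu>)\<^esub>"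
  unfolding Fock_def
proof (rule Ext1_heis_ext_nontrivial)
  fix s :: "fock \<Rightarrow> fock \<times> fock"
  assume s: "module_hom_on Heis_plus \<lparr>space = UNIV, act = heis_Y (heis \<nu>)\<rparr>
      \<lparr>space = UNIV \<times> UNIV, act = heis_Y (heis_ext \<nu> 1)\<rparr> s" and sec: "\<forall>y\<in>UNIV. snd (s y) = y"
  obtain x where x: "s 1 = (x, 1)" using sec by (metis UNIV_I prod.collapse)
  have "heis_Y (heis_ext \<nu> 1) omega 1 (s 1) = s (heis_Y (heis \<nu>) omega 1 1)"
    using module_hom_onD(3)[OF s _ omega_mem, of 1 1] by simp
  also have "\<dots> = \<nu> ^ 2 *\<^sub>C s 1"
    unfolding omega_1_vacuum using module_hom_onD(2)[OF s, of 1] by simp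
  finally have "Poly_Mapping.lookup (fst (heis_Y (heis_ext \<nu> 1) omega 1 (x, 1))) {#} = \<nu> ^ 2 * Poly_Mapping.lookup x {#}"
    by (simp add: x cscale_prod_def cscale_complex_def)
  \<comment> \<open>The terms $\<nu>^2$ times the constant coefficient of \<open>x\<close> cancel,
    leaving $2\<nu>=0$ for every lift of the vacuum.\<close>
  then show False using assms by (simp add: omega_1_const)
qed (auto simp: cvec.subspace_UNIV)

section \<open>Extensions between the two parity eigenspaces\<close>

definition parity :: "complex \<Rightarrow> fock set"
  where "parity \<sigma> = {a. theta a = \<sigma> *\<^sub>C a}"

lemma subspace_parity: "cvec.subspace (parity \<sigma>)"
  by (auto simp: cvec.subspace_def parity_def clinear_op_0[OF linear_theta] clinear_op_add[OF linear_theta]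
      clinear_op_scale[OF linear_theta] cscale_add_right cvec.scale_zero_right cscale_cscale mult.commute)

lemma Heis_minus_eq: "Heis_minus = \<lparr>space = parity (- 1), act = heis_Y (heis 0)\<rparr>"
  by (simp add: Heis_minus_def Heis_def parity_def cvec.scale_minus_left cscale_one)

lemma adjoint_Heis_plus_eq: "adjoint_module Heis_plus = \<lparr>space = parity 1, act = heis_Y (heis 0)\<rparr>"
  by (simp add: adjoint_module_def Heis_plus_def Heis_def parity_def cscale_one)

text \<open>\<open>?T\<close> must anticommute with every mode. On each component
  \<open>theta\<close> does this up to the scalar, but the off-diagonal part of $h(0)$ commutes with
  \<open>theta\<close>, so its sign has to come from opposite scalars on the two components. Hence
  submodule and quotient have opposite parity. Since $\<sigma>^2=1$, the fixed vectors of
  \<open>?T\<close> are exactly the given product.\<close>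

lemma parity_closed:
  assumes "\<sigma> ^ 2 = 1" and a: "theta a = a" and u: "u \<in> parity (- \<sigma>) \<times> parity \<sigma>"
  shows "heis_Y (heis_ext 0 \<epsilon>) a n u \<in> parity (- \<sigma>) \<times> parity \<sigma>"
proof -
  let ?T = "\<lambda>u :: fock \<times> fock. ((- \<sigma>) *\<^sub>C theta (fst u), \<sigma> *\<^sub>C theta (snd u))"
  have \<sigma>: "\<sigma> * \<sigma> = 1" using assms(1) by (simp add: power2_eq_square)
  have fixed: "?T v = v \<longleftrightarrow> v \<in> parity (- \<sigma>) \<times> parity \<sigma>" for v
  proof -
    have "\<tau> *\<^sub>C w = x \<longleftrightarrow> w = \<tau> *\<^sub>C x" if "\<tau> * \<tau> = 1" for \<tau> and w x :: fock
      using that by (metis cscale_cscale cscale_one)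
    from this[of "- \<sigma>"] this[of \<sigma>] \<sigma> show ?thesis
      by (simp add: prod_eq_iff parity_def mem_Times_iff)
  qed
  have "?T (heis_Y (heis_ext 0 \<epsilon>) a n u) = heis_Y (heis_ext 0 \<epsilon>) (theta a) n (?T u)"
  proof (rule heis_Y_theta[where f = ?T, OF heisenberg_field_heis_ext heisenberg_field_heis_ext])
    show "clinear_op ?T"
      using linear_theta
      by (simp add: linear_between_UNIV cscale_prod_def cscale_add_right cscale_cscale mult.commute)
    have minus: "heis 0 n (- v) = - heis 0 n v" for n v
      using V.h_simps(3)[of n "- 1" v] by (simp add: cvec.scale_minus_left cscale_one)
    show "?T (heis_ext 0 \<epsilon> n u) = - heis_ext 0 \<epsilon> n (?T u)" for n u
      by (simp add: heis_ext_def theta_heis V.h_simps clinear_op_add[OF linear_theta]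
          clinear_op_scale[OF linear_theta] cscale_add_right cscale_cscale cvec.scale_minus_left
          cvec.scale_minus_right cvec.scale_right_diff_distrib mult.commute minus clinear_op_0[OF linear_theta])
  qed
  moreover have "?T u = u" using fixed[of u] u by (rule iffD2)
  ultimately have "?T (heis_Y (heis_ext 0 \<epsilon>) a n u) = heis_Y (heis_ext 0 \<epsilon>) a n u"
    by (simp only: a)
  then show ?thesis by (simp only: fixed)
qed

lemma Ext1_plus_minus:
  "\<exists>\<xi>\<in>carrier (Ext1 Heis_plus (adjoint_module Heis_plus) Heis_minus).
    \<xi> \<noteq> \<one>\<^bsub>Ext1 Heis_plus (adjoint_module Heis_plus) Heis_minus\<^esub>"
  unfolding adjoint_Heis_plus_eq Heis_minus_eq
proof (rule Ext1_heis_ext_nontrivial)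
  fix s
  assume s: "module_hom_on Heis_plus \<lparr>space = parity 1, act = heis_Y (heis 0)\<rparr>
      \<lparr>space = parity (- 1) \<times> parity 1, act = heis_Y (heis_ext 0 1)\<rparr> s" and sec: "\<forall>y\<in>parity 1. snd (s y) = y"
  have 1: "1 \<in> parity 1" by (simp add: parity_def theta_mon cscale_one flip: single_one)
  obtain x where x: "s 1 = (x, 1)" using sec 1 by (metis prod.collapse)
  have "heis_Y (heis_ext 0 1) omega 0 (s 1) = s (heis_Y (heis 0) omega 0 1)"
    using module_hom_onD(3)[OF s _ omega_mem, of 1 0] 1 by simp
  also have "\<dots> = 0"
    unfolding omega_0_vacuum using module_hom_onD(2)[OF s, of 1 0] 1 by (simp add: cvec.scale_zero_left)
  \<comment> \<open>The coefficient at $x_0$ is 2 whatever lift \<open>x\<close> was chosen.\<close>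
  finally show False using omega_0_var[of x 1] by (simp add: x)
qed (use parity_closed[of 1] in \<open>auto simp: subspace_parity\<close>)

lemma Ext1_minus_plus:
  "\<exists>\<xi>\<in>carrier (Ext1 Heis_plus Heis_minus (adjoint_module Heis_plus)).
    \<xi> \<noteq> \<one>\<^bsub>Ext1 Heis_plus Heis_minus (adjoint_module Heis_plus)\<^esub>"
  unfolding adjoint_Heis_plus_eq Heis_minus_eq
proof (rule Ext1_heis_ext_nontrivial)
  fix s
  assume s: "module_hom_on Heis_plus \<lparr>space = parity (- 1), act = heis_Y (heis 0)\<rparr>
      \<lparr>space = parity 1 \<times> parity (- 1), act = heis_Y (heis_ext 0 1)\<rparr> s" and sec: "\<forall>y\<in>parity (- 1). snd (s y) = y"
  let ?x = "mon {#0#}"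
  have 1: "?x \<in> parity (- 1)" by (simp add: parity_def theta_mon)
  obtain x where x: "s ?x = (x, ?x)" using sec 1 by (metis prod.collapse)
  have "heis_Y (heis_ext 0 1) omega 2 (s ?x) = s (heis_Y (heis 0) omega 2 ?x)"
    using module_hom_onD(3)[OF s _ omega_mem, of ?x 2] 1 by simp
  also have "\<dots> = 0"
    unfolding omega_2_var using module_hom_onD(2)[OF s, of ?x 0] 1 by (simp add: cvec.scale_zero_left)
  \<comment> \<open>Again the constant coefficient is 2, independently of \<open>x\<close>.\<close>
  finally show False using omega_2_const[of x ?x] by (simp add: x)
qed (use parity_closed[of "- 1"] in \<open>auto simp: subspace_parity\<close>)

theorem theorem6p6:
  shows "(\<exists>\<xi>\<in>carrier (Ext1 Heis_plus (adjoint_module Heis_plus) Heis_minus).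
      \<xi> \<noteq> \<one>\<^bsub>Ext1 Heis_plus (adjoint_module Heis_plus) Heis_minus\<^esub>) \<and>
    (\<exists>\<xi>\<in>carrier (Ext1 Heis_plus Heis_minus (adjoint_module Heis_plus)).
      \<xi> \<noteq> \<one>\<^bsub>Ext1 Heis_plus Heis_minus (adjoint_module Heis_plus)\<^esub>) \<and>
    (\<forall>\<nu> :: complex. \<nu> \<noteq> 0 \<longrightarrow>
      (\<exists>\<xi>\<in>carrier (Ext1 Heis_plus (Fock \<nu>) (Fock \<nu>)).
        \<xi> \<noteq> \<one>\<^bsub>Ext1 Heis_plus (Fock \<nu>) (Fock \<nu>)\<^esub>))"
  using Ext1_plus_minus Ext1_minus_plus Ext1_Fock_Fock by blast

end
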